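(* For every positive integer $k$ and every real $r\ge 1$ there is a constant $c_{k,r}$, depending only on $k$ and $r$, such that the following holds. Let $\mathcal{S}$ be a family of segments in the plane such that no $k$ members of $\mathcal{S}$ pairwise cross. If the ratio of the length of the longest segment of $\mathcal{S}$ to the length of the shortest segment of $\mathcal{S}$ is at most $r$, then $\chi(\mathcal{S})\le c_{k,r}$.
   Context: All families are finite, and segments are closed and of positive length. For a family $\mathcal{S}$ of sets in the plane, the intersection graph $G(\mathcal{S})$ has vertex set $\mathcal{S}$, with two members adjacent if and only if they have nonempty intersection; $\chi(\mathcal{S})$ denotes the chromatic number of $G(\mathcal{S})$. The words "cross" and "intersect" are used interchangeably: two members cross if they have nonempty intersection, so "no $k$ members pairwise cross" means that $G(\mathcal{S})$ has no clique on $k$ vertices. *)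

theory Defs
  imports "HOL-Analysis.Analysis" "Graph_Theory.Pair_Digraph"
begin

type_synonym plane = "real ^ 2"

definition is_segment :: "'a::euclidean_space set \<Rightarrow> bool" where
  "is_segment s \<longleftrightarrow> (\<exists>a b. a \<noteq> b \<and> s = closed_segment a b)"

text \<open>
  Only meaningful for segments, where the two endpoints are determined up to order
  (see \<open>segment_length_closed_segment\<close>).
\<close>
definition segment_length :: "'a::euclidean_space set \<Rightarrow> real" where
  "segment_length s = (THE l. \<exists>a b. s = closed_segment a b \<and> l = dist a b)"

lemma segment_length_closed_segment [simp]:
  "segment_length (closed_segment a b) = dist a b"
  unfolding segment_length_def
proof (rule the_equality)
  fix l assume "\<exists>a' b'. closed_segment a b = closed_segment a' b' \<and> l = dist a' b'"
  then obtain a' b' where "{a, b} = {a', b'}" and l: "l = dist a' b'"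
    using closed_segment_eq by metis
  then show "l = dist a b"
    by (auto simp: doubleton_eq_iff dist_commute)
qed blast

text \<open>
  Undirected simple graphs are represented as in the locale \<^locale>\<open>pair_graph\<close>: a finite
  vertex set with a symmetric, irreflexive set of arcs.
\<close>
definition intersection_graph :: "'a set set \<Rightarrow> 'a set pair_pre_digraph" where
  "intersection_graph S =
     \<lparr> pverts = S, parcs = {(A, B). A \<in> S \<and> B \<in> S \<and> A \<noteq> B \<and> A \<inter> B \<noteq> {}} \<rparr>"

lemma pair_graph_intersection_graph:
  assumes "finite S"
  shows "pair_graph (intersection_graph S)"
proof
  have "parcs (intersection_graph S) \<subseteq> S \<times> S"
    by (auto simp: intersection_graph_def)
  then show "finite (parcs (intersection_graph S))"
    using assms by (meson finite_SigmaI finite_subset)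
  show "symmetric (with_proj (intersection_graph S))"
    by (auto simp: symmetric_def intersection_graph_def sym_def arcs_ends_def arc_to_ends_def)
qed (use assms in \<open>auto simp: intersection_graph_def\<close>)

definition is_clique :: "'v pair_pre_digraph \<Rightarrow> 'v set \<Rightarrow> bool" where
  "is_clique G K \<longleftrightarrow> K \<subseteq> pverts G \<and> pairwise (\<lambda>u v. (u, v) \<in> parcs G) K"

definition proper_coloring :: "'v pair_pre_digraph \<Rightarrow> nat \<Rightarrow> ('v \<Rightarrow> nat) \<Rightarrow> bool" where
  "proper_coloring G n f \<longleftrightarrow>
     f ` pverts G \<subseteq> {..<n} \<and> (\<forall>(u, v) \<in> parcs G. f u \<noteq> f v)"

text \<open>
  For a finite loopless graph the minimum is attained (see \<open>chromatic_number_attained\<close>);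
  for other graphs it may be over an empty set.
\<close>
definition chromatic_number :: "'v pair_pre_digraph \<Rightarrow> nat" where
  "chromatic_number G = (LEAST n. \<exists>f. proper_coloring G n f)"

lemma chromatic_number_attained:
  assumes "pair_graph G"
  shows "\<exists>f. proper_coloring G (chromatic_number G) f"
proof -
  interpret pair_graph G by fact
  obtain f :: "'a \<Rightarrow> nat" where f: "bij_betw f (pverts G) {0..<card (pverts G)}"
    using ex_bij_betw_finite_nat[OF pair_finite_verts] by blast
  have "proper_coloring G (card (pverts G)) f"
    unfolding proper_coloring_def
  proof (intro conjI ballI)
    show "f ` pverts G \<subseteq> {..<card (pverts G)}"
      using f by (auto simp: bij_betw_def)
    fix e assume e: "e \<in> parcs G"
    obtain u v where uv: "e = (u, v)" by (cases e)
    have "u \<in> pverts G" "v \<in> pverts G" "u \<noteq> v"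
      using e uv in_arcsD1 in_arcsD2 pair_no_loops by fastforce+
    then show "case e of (u, v) \<Rightarrow> f u \<noteq> f v"
      using f uv by (auto simp: bij_betw_def inj_on_def)
  qed
  then show ?thesis
    unfolding chromatic_number_def by (intro LeastI) blast
qed

end

theory Submission
  imports Defs
begin

text \<open>
  Up to finitely many classes, the segments of a class all cross a vertical strip and only
  segments of the same class meet. Inside the strip the crossings form a comparability
  graph. On either side, the segments that do not cross inside the strip are grounded strings
  whose supporting lines converge, so that crossing times satisfy a betweenness law. This law
  is all that is used, and such systems are \<open>\<chi>\<close>-bounded by induction on the clique number:

  In a breadth-first layer, the strings trapped under an edge \<open>u v\<close> are supported by strings
  of the previous layer that cross \<open>u\<close> or \<open>v\<close>. Relative to an independent set \<open>W\<close> of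
  such supports every trapped string occupies an interval of slots, and a clique that shares a
  slot extends by a member of \<open>W\<close>, so the induction hypothesis colors it. Only edges of shift
  type remain, where one interval ends where the other begins. Here overlapping intervals force
  adjacency, so the overlap graph has small clique number; since interval overlap graphs are
  themselves crossing systems, the induction hypothesis reduces to noncrossing intervals, whose
  end points can be colored with three colors, and this separates the shift edges.
\<close>

text \<open>What resists an induction on cliques is the shift type. In general, intervals joined
  when one ends where the other begins form a shift graph, which is triangle-free and has unbounded
  chromatic number, so bounding the cliques of each slot cannot finish the proof. Geometry has to
  enter once more: the assumption \<open>bad\<close> of \<open>slot_system\<close> says in abstract
  form that interlacing intervals of this kind belong to strings that cross, or else produce a
  meeting before the cut times \<open>m\<close>.

  The induction also dictates how general the objects are. It is applied to strings that are cut off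
  early and to overlap graphs of auxiliary intervals, which need not come from segments. Hence a
  system records a time \<open>t\<close> for every pair, whether or not the pair meets, and puts no
  condition on the lengths \<open>l\<close>.

  For lines over a strip the time is projective: the gap between two lines at the near border
  divided by their gap at the far border. Lines that are parallel or meet on the other side then
  have a time of at least 1, beyond every length, and betweenness says that the mediant of two
  fractions lies between them.\<close>

section \<open>Colorings\<close>

text \<open>The guard \<open>x \<noteq> y\<close>, here and in \<open>clique\<close> and
  \<open>indep\<close>, allows reflexive relations: every segment meets itself.\<close>

definition colorable :: "('a \<Rightarrow> 'a \<Rightarrow> bool) \<Rightarrow> 'a set \<Rightarrow> nat \<Rightarrow> bool" where
  "colorable E S n \<longleftrightarrow>
     (\<exists>f. f ` S \<subseteq> {..<n} \<and> (\<forall>x\<in>S. \<forall>y\<in>S. E x y \<longrightarrow> x \<noteq> y \<longrightarrow> f x \<noteq> f y))"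

definition clique :: "('a \<Rightarrow> 'a \<Rightarrow> bool) \<Rightarrow> 'a set \<Rightarrow> bool" where
  "clique E C \<longleftrightarrow> (\<forall>x\<in>C. \<forall>y\<in>C. x \<noteq> y \<longrightarrow> E x y)"

definition clique_free :: "('a \<Rightarrow> 'a \<Rightarrow> bool) \<Rightarrow> 'a set \<Rightarrow> nat \<Rightarrow> bool" where
  "clique_free E S k \<longleftrightarrow> (\<forall>C\<subseteq>S. clique E C \<longrightarrow> card C < k)"

definition indep :: "('a \<Rightarrow> 'a \<Rightarrow> bool) \<Rightarrow> 'a set \<Rightarrow> bool" where
  "indep E A \<longleftrightarrow> (\<forall>x\<in>A. \<forall>y\<in>A. x \<noteq> y \<longrightarrow> \<not> E x y)"

lemma colorable_cong:
  assumes "colorable F S n" "n \<le> m" "\<And>x y. x \<in> S \<Longrightarrow> y \<in> S \<Longrightarrow> x \<noteq> y \<Longrightarrow> E x y \<Longrightarrow> F x y"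
  shows "colorable E S m"
proof -
  obtain f where f: "f ` S \<subseteq> {..<n}" "\<forall>x\<in>S. \<forall>y\<in>S. F x y \<longrightarrow> x \<noteq> y \<longrightarrow> f x \<noteq> f y"
    using assms(1) unfolding colorable_def by (elim exE conjE)
  show ?thesis unfolding colorable_def
  proof (intro exI[of _ f] conjI)
    show "f ` S \<subseteq> {..<m}" using f(1) assms(2) by fastforce
  qed (use f(2) assms(3) in blast)
qed

lemma colorable_subset: "colorable E S n \<Longrightarrow> A \<subseteq> S \<Longrightarrow> colorable E A n"
  unfolding colorable_def by (meson image_mono order_trans subsetD)

lemma colorable_mono: "colorable E S n \<Longrightarrow> n \<le> m \<Longrightarrow> colorable E S m"
  by (rule colorable_cong)

lemma colorable_empty [simp]: "colorable E {} n"
  by (auto simp: colorable_def)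

lemma colorable_singleton: "colorable E {x} 1"
  unfolding colorable_def by (intro exI[of _ "\<lambda>_. 0"]) auto

lemma colorable_label: "(\<And>x. x \<in> S \<Longrightarrow> g x < n) \<Longrightarrow> colorable (\<lambda>x y. g x \<noteq> g y) S n"
  unfolding colorable_def by (intro exI[of _ g]) auto

text \<open>The device for discarding edges: a factor \<open>a\<close> pays for all edges of
  \<open>F\<close>, and what follows may assume that no two elements are related by
  \<open>F\<close>.\<close>

lemma colorable_refine:
  assumes "colorable F S a" and "\<And>A. A \<subseteq> S \<Longrightarrow> indep F A \<Longrightarrow> colorable E A b"
  shows "colorable E S (a * b)"
proof -
  obtain f where f: "f ` S \<subseteq> {..<a}" "\<forall>x\<in>S. \<forall>y\<in>S. F x y \<longrightarrow> x \<noteq> y \<longrightarrow> f x \<noteq> f y"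
    using assms(1) unfolding colorable_def by (elim exE conjE)
  have "colorable E {x \<in> S. f x = i} b" for i
  proof (rule assms(2))
    show "indep F {x \<in> S. f x = i}" using f(2) unfolding indep_def by (metis (mono_tags, lifting) mem_Collect_eq)
  qed blast
  then have "\<forall>i. \<exists>g. g ` {x \<in> S. f x = i} \<subseteq> {..<b} \<and>
      (\<forall>x\<in>{x \<in> S. f x = i}. \<forall>y\<in>{x \<in> S. f x = i}. E x y \<longrightarrow> x \<noteq> y \<longrightarrow> g x \<noteq> g y)"
    unfolding colorable_def by (intro allI)
  from choice[OF this] obtain g where "\<forall>i. g i ` {x \<in> S. f x = i} \<subseteq> {..<b} \<and>
      (\<forall>x\<in>{x \<in> S. f x = i}. \<forall>y\<in>{x \<in> S. f x = i}. E x y \<longrightarrow> x \<noteq> y \<longrightarrow> g i x \<noteq> g i y)" ..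
  note g = spec[OF this]
  have gb: "g (f x) x < b" if "x \<in> S" for x
    using g[of "f x"] that by blast
  show ?thesis unfolding colorable_def
  proof (intro exI[of _ "\<lambda>x. f x * b + g (f x) x"] conjI ballI impI)
    have "f x * b + g (f x) x < a * b" if "x \<in> S" for x
    proof -
      have "f x < a" using f(1) that by blast
      then have "(f x + 1) * b \<le> a * b" by (intro mult_le_mono1) simp
      then show ?thesis using gb[OF that] by (simp add: algebra_simps)
    qed
    then show "(\<lambda>x. f x * b + g (f x) x) ` S \<subseteq> {..<a * b}" by auto
    fix x y assume xy: "x \<in> S" "y \<in> S" "E x y" "x \<noteq> y"
    show "f x * b + g (f x) x \<noteq> f y * b + g (f y) y"
    proof
      assume eq: "f x * b + g (f x) x = f y * b + g (f y) y"
      have b: "b > 0" using gb[OF xy(1)] by simp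
      have "f x = (f x * b + g (f x) x) div b" using gb[OF xy(1)] b by simp
      also have "\<dots> = f y" unfolding eq using gb[OF xy(2)] b by simp
      finally have "f x = f y" .
      then show False using eq xy g[of "f x"] by auto
    qed
  qed
qed

lemma colorable_label_refine:
  assumes "\<And>x. x \<in> S \<Longrightarrow> g x < n"
    and "\<And>i A. A \<subseteq> S \<Longrightarrow> (\<And>x. x \<in> A \<Longrightarrow> g x = i) \<Longrightarrow> colorable E A b"
  shows "colorable E S (n * b)"
proof (rule colorable_refine[OF colorable_label[of S g n, OF assms(1)]])
  fix A assume A: "A \<subseteq> S" "indep (\<lambda>x y. g x \<noteq> g y) A"
  show "colorable E A b"
  proof (cases "A = {}")
    case False
    then obtain a where "a \<in> A" by blast
    then have "g x = g a" if "x \<in> A" for x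
      using A(2) that unfolding indep_def by metis
    then show ?thesis using assms(2) A(1) by blast
  qed simp
qed

lemma colorable_Un:
  assumes "colorable E A a" "colorable E B b"
  shows "colorable E (A \<union> B) (a + b)"
proof -
  obtain f where f: "f ` A \<subseteq> {..<a}" "\<forall>x\<in>A. \<forall>y\<in>A. E x y \<longrightarrow> x \<noteq> y \<longrightarrow> f x \<noteq> f y"
    using assms(1) unfolding colorable_def by (elim exE conjE)
  obtain g where g: "g ` B \<subseteq> {..<b}" "\<forall>x\<in>B. \<forall>y\<in>B. E x y \<longrightarrow> x \<noteq> y \<longrightarrow> g x \<noteq> g y"
    using assms(2) unfolding colorable_def by (elim exE conjE)
  have fa: "f x < a" if "x \<in> A" for x using f(1) that by blast
  have gb: "g x < b" if "x \<in> B" for x using g(1) that by blast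
  let ?h = "\<lambda>x. if x \<in> A then f x else a + g x"
  have "?h x < a + b" if "x \<in> A \<union> B" for x
    using that fa[of x] gb[of x] by (cases "x \<in> A") auto
  moreover have "?h x \<noteq> ?h y" if "x \<in> A \<union> B" "y \<in> A \<union> B" "E x y" "x \<noteq> y" for x y
  proof (cases "x \<in> A \<longleftrightarrow> y \<in> A")
    case True
    then show ?thesis using that f(2) g(2) by (cases "x \<in> A") auto
  next
    case False
    then show ?thesis using fa[of x] fa[of y] by (cases "x \<in> A") auto
  qed
  ultimately show ?thesis unfolding colorable_def
    by (intro exI[of _ ?h] conjI ballI impI image_subsetI) (simp_all only: lessThan_iff)
qed

lemma colorable_UN:
  assumes "finite C" "\<And>s. s \<in> C \<Longrightarrow> colorable E (A s) c"
  shows "colorable E (\<Union>s\<in>C. A s) (card C * c)"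
  using assms
proof (induction C rule: finite_induct)
  case (insert x C)
  then show ?case
    using colorable_Un[of E "A x" c "\<Union>s\<in>C. A s" "card C * c"] by auto
qed simp

lemma colorable_fibers:
  assumes "\<And>i. colorable E {x \<in> S. g x = i} m"
  shows "colorable (\<lambda>x y. E x y \<and> g x = g y) S m"
proof -
  have "\<forall>i. \<exists>f. f ` {x \<in> S. g x = i} \<subseteq> {..<m} \<and>
      (\<forall>x\<in>{x \<in> S. g x = i}. \<forall>y\<in>{x \<in> S. g x = i}. E x y \<longrightarrow> x \<noteq> y \<longrightarrow> f x \<noteq> f y)"
    using assms unfolding colorable_def by (intro allI)
  from choice[OF this] obtain f where "\<forall>i. f i ` {x \<in> S. g x = i} \<subseteq> {..<m} \<and>
      (\<forall>x\<in>{x \<in> S. g x = i}. \<forall>y\<in>{x \<in> S. g x = i}. E x y \<longrightarrow> x \<noteq> y \<longrightarrow> f i x \<noteq> f i y)" ..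
  note f = spec[OF this]
  show ?thesis unfolding colorable_def
  proof (intro exI[of _ "\<lambda>x. f (g x) x"] conjI ballI impI)
    have "f (g x) x \<in> {..<m}" if "x \<in> S" for x
      using conjunct1[OF f[of "g x"]] that by blast
    then show "(\<lambda>x. f (g x) x) ` S \<subseteq> {..<m}" by blast
    fix x y assume "x \<in> S" "y \<in> S" "E x y \<and> g x = g y" "x \<noteq> y"
    then show "f (g x) x \<noteq> f (g y) y" using f[of "g x"] by auto
  qed
qed

text \<open>Each class of \<open>g\<close> is a union of components, so all classes can share one
  palette.\<close>

lemma colorable_components:
  assumes "\<And>i. colorable E {x \<in> S. g x = i} m"
    and "\<And>x y. x \<in> S \<Longrightarrow> y \<in> S \<Longrightarrow> x \<noteq> y \<Longrightarrow> E x y \<Longrightarrow> g x = g y"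
  shows "colorable E S m"
  by (rule colorable_cong[OF colorable_fibers[of E S g m, OF assms(1)]])
    (use assms(2) in \<open>blast+\<close>)

lemma clique_free_subset: "clique_free E S k \<Longrightarrow> A \<subseteq> S \<Longrightarrow> clique_free E A k"
  by (auto simp: clique_free_def)

text \<open>The color of \<open>x\<close> is the size of a largest chain with top \<open>x\<close>,
  as in the dual of Dilworth's theorem; it grows strictly along \<open>R\<close>.\<close>

lemma colorable_height:
  assumes "finite S" and trans: "\<And>x y z. x \<in> S \<Longrightarrow> y \<in> S \<Longrightarrow> z \<in> S \<Longrightarrow> R x y \<Longrightarrow> R y z \<Longrightarrow> R x z"
    and irrefl: "\<And>x. x \<in> S \<Longrightarrow> \<not> R x x"
    and cf: "clique_free (\<lambda>x y. R x y \<or> R y x) S k"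
  shows "colorable (\<lambda>x y. R x y \<or> R y x) S k"
proof -
  define Ch where "Ch x = {C. C \<subseteq> S \<and> clique (\<lambda>x y. R x y \<or> R y x) C \<and> x \<in> C \<and> (\<forall>y\<in>C. y = x \<or> R y x)}" for x
  define h where "h x = Max (card ` Ch x)" for x
  have fin: "finite (Ch x)" for x
    by (rule finite_subset[of _ "Pow S"]) (use assms(1) in \<open>auto simp: Ch_def\<close>)
  have sing: "{x} \<in> Ch x" if "x \<in> S" for x
    using that by (auto simp: Ch_def clique_def)
  have att: "\<exists>C\<in>Ch x. card C = h x" if "x \<in> S" for x
  proof -
    have "h x \<in> card ` Ch x" unfolding h_def
      by (rule Max_in) (use fin sing[OF that] in auto)
    then show ?thesis by auto
  qed
  have less: "h x < h y" if "R x y" "x \<in> S" "y \<in> S" for x y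
  proof -
    obtain C where C: "C \<in> Ch x" "card C = h x" using att \<open>x \<in> S\<close> by blast
    have Ry: "R z y" if "z \<in> C" for z
    proof (cases "z = x")
      case False
      then have "R z x" "z \<in> S" using C(1) that by (auto simp: Ch_def)
      then show ?thesis using trans[of z x y] \<open>R x y\<close> \<open>x \<in> S\<close> \<open>y \<in> S\<close> by blast
    qed (use \<open>R x y\<close> in simp)
    have y: "y \<notin> C" using Ry irrefl \<open>y \<in> S\<close> by blast
    have "insert y C \<in> Ch y"
      using C(1) Ry \<open>y \<in> S\<close> unfolding Ch_def clique_def by auto
    then have "card (insert y C) \<le> h y" unfolding h_def by (intro Max_ge) (use fin in auto)
    moreover have "finite C" using C(1) assms(1) finite_subset by (auto simp: Ch_def)
    ultimately show ?thesis using y C(2) by simp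
  qed
  have "h x < k" if "x \<in> S" for x
    using att[OF that] cf by (auto simp: Ch_def clique_free_def)
  moreover have "h x \<noteq> h y" if "R x y \<or> R y x" "x \<in> S" "y \<in> S" for x y
    using less[of x y] less[of y x] that by auto
  ultimately show ?thesis unfolding colorable_def by (intro exI[of _ h]) blast
qed

text \<open>The premise \<open>i < \<sigma> e\<close> of the last clause says that \<open>i\<close> is not the last chunk.\<close>
lemma chunks:
  fixes f :: "'a \<Rightarrow> nat"
  assumes "finite T" and fib: "\<And>e. colorable E {x \<in> T. f x = e} c"
  shows "\<exists>\<sigma> :: nat \<Rightarrow> nat. mono \<sigma> \<and> (\<forall>i. colorable E {x \<in> T. \<sigma> (f x) = i} (D + c)) \<and>
           (\<forall>i e. i < \<sigma> e \<longrightarrow> \<not> colorable E {x \<in> T. \<sigma> (f x) = i} D)"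
proof -
  have "\<exists>\<sigma> :: nat \<Rightarrow> nat. mono \<sigma> \<and> (\<forall>e\<ge>n. \<sigma> e = \<sigma> n) \<and>
          (\<forall>i. colorable E {x \<in> T. f x \<le> n \<and> \<sigma> (f x) = i} (D + c)) \<and>
          (\<forall>i<\<sigma> n. \<not> colorable E {x \<in> T. f x \<le> n \<and> \<sigma> (f x) = i} D)" for n
  proof (induction n)
    case 0
    have "colorable E {x \<in> T. f x \<le> 0 \<and> (0::nat) = i} (D + c)" for i
      by (rule colorable_mono[OF colorable_subset[OF fib[of 0]]]) auto
    then show ?case by (intro exI[of _ "\<lambda>_. 0"]) (auto simp: mono_def)
  next
    case (Suc n)
    then obtain \<sigma> :: "nat \<Rightarrow> nat" where s: "mono \<sigma>" "\<And>e. e \<ge> n \<Longrightarrow> \<sigma> e = \<sigma> n"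
      "\<And>i. colorable E {x \<in> T. f x \<le> n \<and> \<sigma> (f x) = i} (D + c)"
      "\<And>i. i < \<sigma> n \<Longrightarrow> \<not> colorable E {x \<in> T. f x \<le> n \<and> \<sigma> (f x) = i} D" by blast
    show ?case
    \<comment> \<open>Greedy choice: the next fiber joins the current chunk while that chunk is
      still \<open>D\<close>-colorable, which costs at most \<open>c\<close> more colors; otherwise
      it opens a new chunk.\<close>
    proof (cases "colorable E {x \<in> T. f x \<le> n \<and> \<sigma> (f x) = \<sigma> n} D")
      case True
      have "colorable E {x \<in> T. f x \<le> Suc n \<and> \<sigma> (f x) = i} (D + c)" for i
      proof (cases "i = \<sigma> n")
        case i: True
        show ?thesis
          by (rule colorable_subset[OF colorable_Un[OF True fib[of "Suc n"]]]) (use i in \<open>auto simp: le_Suc_eq\<close>)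
      next
        case False
        then have "{x \<in> T. f x \<le> Suc n \<and> \<sigma> (f x) = i} = {x \<in> T. f x \<le> n \<and> \<sigma> (f x) = i}"
          using s(2)[of "Suc n"] by (auto simp: le_Suc_eq)
        then show ?thesis using s(3) by simp
      qed
      moreover have "\<not> colorable E {x \<in> T. f x \<le> Suc n \<and> \<sigma> (f x) = i} D" if "i < \<sigma> (Suc n)" for i
      proof -
        have "i < \<sigma> n" using that s(2)[of "Suc n"] by simp
        from s(4)[OF this] show ?thesis
          using colorable_subset[of E "{x \<in> T. f x \<le> Suc n \<and> \<sigma> (f x) = i}" D "{x \<in> T. f x \<le> n \<and> \<sigma> (f x) = i}"]
          by fastforce
      qed
      moreover have "\<forall>e\<ge>Suc n. \<sigma> e = \<sigma> (Suc n)" using s(2) by (metis Suc_leD le_Suc_eq)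
      ultimately show ?thesis using s(1) by blast
    next
      case False
      define \<tau> where "\<tau> e = (if e \<le> n then \<sigma> e else Suc (\<sigma> n))" for e
      have le: "\<sigma> e \<le> \<sigma> n" for e using s(1,2) by (metis linorder_linear monoD order_refl)
      have "mono \<tau>" using s(1) le by (auto simp: \<tau>_def mono_def le_Suc_eq)
      moreover have "\<forall>e\<ge>Suc n. \<tau> e = \<tau> (Suc n)" by (auto simp: \<tau>_def)
      moreover have "colorable E {x \<in> T. f x \<le> Suc n \<and> \<tau> (f x) = i} (D + c)" for i
      proof (cases "i = Suc (\<sigma> n)")
        case True
        show ?thesis
        proof (rule colorable_mono[OF colorable_subset[OF fib[of "Suc n"]]])
          show "{x \<in> T. f x \<le> Suc n \<and> \<tau> (f x) = i} \<subseteq> {x \<in> T. f x = Suc n}"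
          proof
            fix x assume "x \<in> {x \<in> T. f x \<le> Suc n \<and> \<tau> (f x) = i}"
            then have x: "x \<in> T" "f x \<le> Suc n" "\<tau> (f x) = Suc (\<sigma> n)" using True by auto
            have "\<not> f x \<le> n" using x(3) le[of "f x"] by (auto simp: \<tau>_def)
            then show "x \<in> {x \<in> T. f x = Suc n}" using x by simp
          qed
        qed simp
      next
        case False
        then have "{x \<in> T. f x \<le> Suc n \<and> \<tau> (f x) = i} \<subseteq> {x \<in> T. f x \<le> n \<and> \<sigma> (f x) = i}"
          by (auto simp: \<tau>_def split: if_splits)
        then show ?thesis using s(3) colorable_subset by blast
      qed
      moreover have "\<not> colorable E {x \<in> T. f x \<le> Suc n \<and> \<tau> (f x) = i} D" if "i < \<tau> (Suc n)" for i
      proof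
        assume c: "colorable E {x \<in> T. f x \<le> Suc n \<and> \<tau> (f x) = i} D"
        have "colorable E {x \<in> T. f x \<le> n \<and> \<sigma> (f x) = i} D"
          by (rule colorable_subset[OF c]) (auto simp: \<tau>_def)
        then show False using that s(4)[of i] False by (cases "i = \<sigma> n") (auto simp: \<tau>_def)
      qed
      ultimately show ?thesis by blast
    qed
  qed
  then obtain \<sigma> :: "nat \<Rightarrow> nat" where s: "mono \<sigma>" "\<forall>e\<ge>Max (f ` T). \<sigma> e = \<sigma> (Max (f ` T))"
     "\<forall>i. colorable E {x \<in> T. f x \<le> Max (f ` T) \<and> \<sigma> (f x) = i} (D + c)"
     "\<forall>i<\<sigma> (Max (f ` T)). \<not> colorable E {x \<in> T. f x \<le> Max (f ` T) \<and> \<sigma> (f x) = i} D" by meson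
  have eq: "{x \<in> T. f x \<le> Max (f ` T) \<and> \<sigma> (f x) = i} = {x \<in> T. \<sigma> (f x) = i}" for i
    using assms(1) by auto
  have le: "\<sigma> e \<le> \<sigma> (Max (f ` T))" for e using s(1,2) by (metis linorder_linear monoD order_refl)
  show ?thesis
  proof (intro exI[of _ \<sigma>] conjI allI impI)
    show "mono \<sigma>" "colorable E {x \<in> T. \<sigma> (f x) = i} (D + c)" for i
      using s(1,3) unfolding eq by blast+
    fix i e assume "i < \<sigma> e"
    then show "\<not> colorable E {x \<in> T. \<sigma> (f x) = i} D"
      using s(4) le[of e] unfolding eq by simp
  qed
qed

lemma order_index:
  fixes p :: "'a \<Rightarrow> real"
  assumes "finite W" "inj_on p W"
  shows "\<exists>e. bij_betw e W {..<card W} \<and> (\<forall>x\<in>W. \<forall>y\<in>W. e x < e y \<longleftrightarrow> p x < p y)"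
proof -
  define e where "e x = card {y \<in> W. p y < p x}" for x
  have lt: "e x < e y" if "x \<in> W" "y \<in> W" "p x < p y" for x y
    unfolding e_def by (rule psubset_card_mono) (use assms that in auto)
  have iff: "e x < e y \<longleftrightarrow> p x < p y" if "x \<in> W" "y \<in> W" for x y
    using lt that assms(2) by (metis inj_onD linorder_neqE_linordered_idom not_less_iff_gr_or_eq)
  have inj: "inj_on e W" using lt assms(2) by (metis inj_onD inj_onI linorder_neqE_linordered_idom nat_neq_iff)
  have sub: "e ` W \<subseteq> {..<card W}"
  proof
    fix i assume "i \<in> e ` W"
    then obtain x where x: "x \<in> W" "i = e x" by blast
    have "card {y \<in> W. p y < p x} < card W"
      by (rule psubset_card_mono) (use assms x in auto)
    then show "i \<in> {..<card W}" using x by (simp add: e_def)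
  qed
  have "bij_betw e W {..<card W}"
    using inj sub by (simp add: bij_betw_def card_image card_subset_eq)
  then show ?thesis using iff by blast
qed

text \<open>The interval is split at an interior point that no arc inside it, except \<open>(p, q)\<close>, jumps over.\<close>
lemma noncrossing_arcs_interval:
  fixes F :: "(nat \<times> nat) set"
  assumes nc: "\<And>a b x y. (a, b) \<in> F \<Longrightarrow> (x, y) \<in> F \<Longrightarrow> a < x \<Longrightarrow> x < b \<Longrightarrow> b < y \<Longrightarrow> False"
    and lt: "\<And>a b. (a, b) \<in> F \<Longrightarrow> a < b"
  shows "p < q \<Longrightarrow> c \<noteq> d \<Longrightarrow> c < 3 \<Longrightarrow> d < 3 \<Longrightarrow> \<exists>\<psi> :: nat \<Rightarrow> nat. \<psi> p = c \<and> \<psi> q = d \<and> (\<forall>i. \<psi> i < 3) \<and>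
           (\<forall>(a, b)\<in>F. p \<le> a \<longrightarrow> b \<le> q \<longrightarrow> \<psi> a \<noteq> \<psi> b)"
proof (induction "q - p" arbitrary: p q c d rule: less_induct)
  case less
  show ?case
  proof (cases "q = p + 1")
    case True
    show ?thesis
    proof (intro exI[of _ "\<lambda>i. if i = p then c else d"] conjI ballI)
      fix e assume "e \<in> F"
      then show "case e of (a, b) \<Rightarrow> p \<le> a \<longrightarrow> b \<le> q \<longrightarrow> (if a = p then c else d) \<noteq> (if b = p then c else d)"
        using lt[of "fst e" "snd e"] True less.prems(2) by (cases e) auto
    qed (use less.prems True in auto)
  next
    case False
    \<comment> \<open>\<open>r\<close> is the end of the longest arc from \<open>p\<close> that
      stops before \<open>q\<close>, with \<open>p + 1\<close> as default. Another arc jumping over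
      \<open>r\<close> would be a longer one from \<open>p\<close>, or it would interlace with
      \<open>(p, r)\<close>.\<close>
    define Y where "Y = {y. (p, y) \<in> F \<and> y < q} \<union> {p + 1}"
    define r where "r = Max Y"
    have finY: "finite Y" by (rule finite_subset[of _ "{..q}"]) (use less.prems(1) in \<open>auto simp: Y_def\<close>)
    have "r \<in> Y" unfolding r_def using finY by (intro Max_in) (auto simp: Y_def)
    then have r: "p < r" "r < q" "r = p + 1 \<or> (p, r) \<in> F"
      using lt False less.prems(1) by (auto simp: Y_def)
    have ge: "y \<le> r" if "(p, y) \<in> F" "y < q" for y
      unfolding r_def using finY that by (intro Max_ge) (auto simp: Y_def)
    have cut: "b \<le> r \<or> r \<le> a" if "(a, b) \<in> F" "p \<le> a" "b \<le> q" "(a, b) \<noteq> (p, q)" for a b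
    proof (rule ccontr)
      assume "\<not> ?thesis"
      then have ab: "a < r" "r < b" by auto
      show False
      proof (cases "a = p")
        case True
        then show ?thesis using ge[of b] that ab by auto
      next
        case False
        then show ?thesis using r(3) nc[of p r a b] that ab by auto
      qed
    qed
    \<comment> \<open>The third color. Because the colors of both ends are prescribed in the
      induction, the colorings of the two halves agree at \<open>r\<close>.\<close>
    define z where "z = (if 0 \<notin> {c, d} then 0 else if 1 \<notin> {c, d} then 1 else (2::nat))"
    have z: "z \<noteq> c" "z \<noteq> d" "z < 3" unfolding z_def using less.prems by auto
    obtain f where f: "f p = c" "f r = z" "\<forall>i. f i < 3"
      "\<forall>(a, b)\<in>F. p \<le> a \<longrightarrow> b \<le> r \<longrightarrow> f a \<noteq> f b"
      using less.hyps[OF diff_less_mono[OF r(2)] r(1) z(1)[symmetric] less.prems(3) z(3)] r(1) by auto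
    obtain g where g: "g r = z" "g q = d" "\<forall>i. g i < 3"
      "\<forall>(a, b)\<in>F. r \<le> a \<longrightarrow> b \<le> q \<longrightarrow> g a \<noteq> g b"
      using less.hyps[OF diff_less_mono2[OF r(1) less.prems(1)] r(2) z(2) z(3) less.prems(4)] by auto
    define h where "h i = (if i \<le> r then f i else g i)" for i
    have "h a \<noteq> h b" if "(a, b) \<in> F" "p \<le> a" "b \<le> q" for a b
    proof (cases "(a, b) = (p, q)")
      case True
      then show ?thesis using f g r less.prems by (auto simp: h_def)
    next
      case ab: False
      have "a < b" using lt that by blast
      from cut[OF that ab] show ?thesis
      proof
        assume "b \<le> r" then show ?thesis using f(4) that \<open>a < b\<close> by (auto simp: h_def)
      next
        assume "r \<le> a"
        then have "h a = g a" "h b = g b" using f(2) g(1) \<open>a < b\<close> by (auto simp: h_def)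
        then show ?thesis using g(4) that \<open>r \<le> a\<close> by auto
      qed
    qed
    moreover have "h p = c" "h q = d" "\<forall>i. h i < 3"
      using f(1,3) g(2,3) r by (auto simp: h_def)
    ultimately show ?thesis by blast
  qed
qed

text \<open>Noncrossing arcs over a line form an outerplanar graph, hence three colors.\<close>

lemma noncrossing_arcs:
  fixes F :: "(nat \<times> nat) set"
  assumes "finite F"
    and nc: "\<And>a b x y. (a, b) \<in> F \<Longrightarrow> (x, y) \<in> F \<Longrightarrow> a < x \<Longrightarrow> x < b \<Longrightarrow> b < y \<Longrightarrow> False"
    and lt: "\<And>a b. (a, b) \<in> F \<Longrightarrow> a < b"
  shows "\<exists>\<psi> :: nat \<Rightarrow> nat. (\<forall>i. \<psi> i < 3) \<and> (\<forall>(a, b)\<in>F. \<psi> a \<noteq> \<psi> b)"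
proof -
  define q where "q = Suc (Max (snd ` F))"
  have "b \<le> q" if "(a, b) \<in> F" for a b
    using that assms(1) unfolding q_def by (metis Max_ge finite_imageI image_eqI le_Suc_eq snd_conv)
  moreover obtain \<psi> :: "nat \<Rightarrow> nat" where "\<forall>i. \<psi> i < 3" "\<forall>(a, b)\<in>F. 0 \<le> a \<longrightarrow> b \<le> q \<longrightarrow> \<psi> a \<noteq> \<psi> b"
    using noncrossing_arcs_interval[of F 0 q 0 1] nc lt by (auto simp: q_def)
  ultimately show ?thesis by (intro exI[of _ \<psi>]) auto
qed

section \<open>Crossing systems and shift edges\<close>

lemma ex_maximizer:
  fixes f :: "'a \<Rightarrow> 'b :: linorder"
  assumes "finite C" "C \<noteq> {}"
  shows "\<exists>z\<in>C. \<forall>x\<in>C. f x \<le> f z"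
proof -
  have "Max (f ` C) \<in> f ` C" using assms by simp
  then obtain z where "z \<in> C" "f z = Max (f ` C)" by auto
  then show ?thesis using assms(1) by (intro bexI[of _ z]) auto
qed

lemma mod_3_gap:
  fixes a b :: nat
  assumes "a mod 3 = b mod 3" "a < b"
  shows "a + 3 \<le> b"
proof -
  have "3 dvd b - a" using assms mod_eq_dvd_iff_nat[of a b 3] by simp
  then have "3 \<le> b - a" using assms(2) by (intro dvd_imp_le) auto
  then show ?thesis using assms(2) by simp
qed

definition adj :: "('a \<Rightarrow> 'a \<Rightarrow> real) \<Rightarrow> ('a \<Rightarrow> real) \<Rightarrow> 'a \<Rightarrow> 'a \<Rightarrow> bool" where
  "adj t l x y \<longleftrightarrow> t x y \<le> l x \<and> t x y \<le> l y"

text \<open>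
  Strings are grounded at the positions \<open>p\<close>; the strings of \<open>x\<close> and \<open>y\<close>, if prolonged,
  would meet at time \<open>t x y\<close>, but the string of \<open>x\<close> ends at time \<open>l x\<close>.
\<close>
locale crossing_system =
  fixes S :: "'a set" and p :: "'a \<Rightarrow> real" and t :: "'a \<Rightarrow> 'a \<Rightarrow> real"
  assumes finite: "finite S" and inj: "inj_on p S"
    and sym: "t x y = t y x"
    and between: "x \<in> S \<Longrightarrow> y \<in> S \<Longrightarrow> z \<in> S \<Longrightarrow> p x < p y \<Longrightarrow> p y < p z \<Longrightarrow>
      t x y < t x z \<and> t x z < t y z \<or> t y z < t x z \<and> t x z < t x y \<or> t x y = t x z \<and> t x z = t y z"
begin

lemma pos_cases: "x \<in> S \<Longrightarrow> y \<in> S \<Longrightarrow> x \<noteq> y \<Longrightarrow> p x < p y \<or> p y < p x"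
  using inj by (metis inj_onD linorder_neqE_linordered_idom)

lemma adj_sym: "adj t l x y \<longleftrightarrow> adj t l y x"
  by (auto simp: adj_def sym)

lemma subsystem: "A \<subseteq> S \<Longrightarrow> crossing_system A p t"
  by unfold_locales
    (use between in \<open>blast intro: finite_subset[OF _ finite] inj_on_subset[OF inj] sym\<close>)+

lemma mirror: "crossing_system S (\<lambda>x. - p x) t"
proof
  show "inj_on (\<lambda>x. - p x) S" using inj by (auto simp: inj_on_def)
  fix x y z assume "x \<in> S" "y \<in> S" "z \<in> S" "- p x < - p y" "- p y < - p z"
  then show "t x y < t x z \<and> t x z < t y z \<or> t y z < t x z \<and> t x z < t x y \<or> t x y = t x z \<and> t x z = t y z"
    using between[of z y x] sym[of x y] sym[of y z] sym[of x z] by auto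
qed (use finite sym in auto)

end

section \<open>Interval overlap graphs as crossing systems\<close>

text \<open>The oriented edge relation of a circle graph: the intervals interlace, and neither
  nesting nor a shared end point counts.\<close>

definition overlap :: "('a \<Rightarrow> nat) \<Rightarrow> ('a \<Rightarrow> nat) \<Rightarrow> 'a \<Rightarrow> 'a \<Rightarrow> bool" where
  "overlap a b x y \<longleftrightarrow> a x < a y \<and> a y < b x \<and> b x < b y"

text \<open>A mixed-radix number encodes the lexicographic order by left end, then by decreasing
  right end, then by an arbitrary index. On equal left ends the longer interval comes first, so a
  later position with a larger right end also has a strictly larger left end.\<close>

lemma overlap_positions:
  fixes a b :: "'a \<Rightarrow> nat"
  assumes "finite A"
  shows "\<exists>n :: 'a \<Rightarrow> nat. inj_on n A \<and>
    (\<forall>x\<in>A. \<forall>y\<in>A. n x < n y \<longrightarrow> a x < a y \<or> a x = a y \<and> b y \<le> b x)"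
proof -
  obtain e :: "'a \<Rightarrow> nat" where e: "bij_betw e A {0..<card A}"
    using ex_bij_betw_finite_nat[OF assms] by blast
  define N where "N = card A"
  define B where "B = Suc (Max (b ` A))"
  define v where "v x = a x * B + (B - b x)" for x
  define n where "n x = v x * N + e x" for x
  have eN: "e x < N" if "x \<in> A" for x using e that by (auto simp: bij_betw_def N_def)
  have bB: "b x < B" if "x \<in> A" for x using assms that by (simp add: B_def less_Suc_eq_le)
  have "a x < a y \<or> a x = a y \<and> b y \<le> b x" if "x \<in> A" "y \<in> A" "n x < n y" for x y
  proof -
    have "v x \<le> v y"
    proof (rule ccontr)
      assume "\<not> v x \<le> v y"
      then have "(v y + 1) * N \<le> v x * N" by (intro mult_le_mono1) simp
      then show False using that(3) eN[OF that(2)] by (simp add: n_def)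
    qed
    moreover have "a x \<le> a y"
    proof (rule ccontr)
      assume "\<not> a x \<le> a y"
      then have "(a y + 1) * B \<le> a x * B" by (intro mult_le_mono1) simp
      then show False using \<open>v x \<le> v y\<close> bB[OF that(1)] by (simp add: v_def)
    qed
    ultimately show ?thesis using bB[OF that(1)] bB[OF that(2)] by (cases "a x = a y") (auto simp: v_def)
  qed
  moreover have "inj_on n A"
  proof (rule inj_onI)
    fix x y assume xy: "x \<in> A" "y \<in> A" "n x = n y"
    have "n x mod N = e x" "n y mod N = e y" using eN[OF xy(1)] eN[OF xy(2)] by (simp_all add: n_def)
    then have "e x = e y" using xy(3) by simp
    then show "x = y" using e xy by (auto simp: bij_betw_def inj_on_def)
  qed
  ultimately show ?thesis by blast
qed

text \<open>
  The string of \<open>x\<close> waits at its left end \<open>a x\<close> until it runs to the right shortly before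
  its death, at a time governed by \<open>b x\<close>. It then crosses the strings that are still waiting
  below \<open>b x\<close> first (phase 0), next the remaining waiting ones (phase 1) and finally those that
  have run away before (phase 2).
\<close>
lemma overlap_system:
  fixes a b :: "'a \<Rightarrow> nat"
  assumes "finite A"
  shows "\<exists>q u m. crossing_system A q u \<and>
           (\<forall>x\<in>A. \<forall>y\<in>A. x \<noteq> y \<longrightarrow> (adj u m x y \<longleftrightarrow> overlap a b x y \<or> overlap a b y x))"
proof -
  obtain n :: "'a \<Rightarrow> nat" where n: "inj_on n A"
    and ord: "\<And>x y. x \<in> A \<Longrightarrow> y \<in> A \<Longrightarrow> n x < n y \<Longrightarrow> a x < a y \<or> a x = a y \<and> b y \<le> b x"
    using overlap_positions[OF assms, of a b] by blast
  \<comment> \<open>\<open>P\<close> exceeds twice every position, which keeps the ranges of the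
    three phases \<open>n y\<close>, \<open>P + n y\<close> and \<open>2 * P - n y\<close>
    disjoint.\<close>
  define P where "P = 2 * int (Suc (Max (n ` A)))"
  have P: "2 * int (n x) < P" if "x \<in> A" for x
  proof -
    have "n x \<le> Max (n ` A)" using assms that by simp
    then show ?thesis by (simp add: P_def)
  qed
  have P0: "P > 0" by (simp add: P_def)
  \<comment> \<open>The order of death: by right end, and on equal right ends the later position
    dies first, so that a tie never counts as an overlap.\<close>
  define \<beta> where "\<beta> x = int (b x) * P - int (n x)" for x
  have \<beta>: "\<beta> x < \<beta> y \<longleftrightarrow> b x < b y" if xy: "x \<in> A" "y \<in> A" "n x < n y" for x y
  proof
    assume "\<beta> x < \<beta> y"
    show "b x < b y"
    proof (rule ccontr)
      assume "\<not> b x < b y"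
      then have "int (b y) * P \<le> int (b x) * P" using P0 by (intro mult_right_mono) auto
      then show False using \<open>\<beta> x < \<beta> y\<close> xy(3) by (simp add: \<beta>_def)
    qed
  next
    assume "b x < b y"
    then have "(int (b x) + 1) * P \<le> int (b y) * P" using P0 by (intro mult_right_mono) auto
    then show "\<beta> x < \<beta> y" using P[OF xy(2)] P0 by (simp add: \<beta>_def algebra_simps)
  qed
  have \<beta>_ne: "\<beta> x \<noteq> \<beta> y" if xy: "x \<in> A" "y \<in> A" "n x < n y" for x y
  proof (cases "b x < b y")
    case True
    then show ?thesis using \<beta>[OF xy] by simp
  next
    case False
    then have "int (b y) * P \<le> int (b x) * P" using P0 by (intro mult_right_mono) auto
    then show ?thesis using xy(3) by (simp add: \<beta>_def)
  qed
  define ph where "ph x y = (if \<beta> x < \<beta> y then (if a y < b x then int (n y) else P + int (n y))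
    else 2 * P - int (n y))" for x y
  have ph: "0 \<le> ph x y" "ph x y \<le> 2 * P" if "x \<in> A" "y \<in> A" for x y
    using P[OF that(2)] P0 by (auto simp: ph_def)
  define v where "v x y = 4 * P * \<beta> x + ph x y" for x y
  have later: "4 * P * \<beta> x + 4 * P \<le> 4 * P * \<beta> y" if "\<beta> x < \<beta> y" for x y
  proof -
    have "4 * P * (\<beta> x + 1) \<le> 4 * P * \<beta> y" using that P0 by (intro mult_left_mono) auto
    then show ?thesis by (simp add: algebra_simps)
  qed
  define u where "u x y = (if n x < n y then real_of_int (v x y) else if n y < n x then real_of_int (v y x) else 0)" for x y
  have key: "v x y < v x z \<and> v x z < v y z \<or> v y z < v x z \<and> v x z < v x y"
    if xyz: "x \<in> A" "y \<in> A" "z \<in> A" "n x < n y" "n y < n z" for x y z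
  proof (cases "\<beta> x < \<beta> y")
    case True
    have "ph x y < ph x z"
      using True ord[of y z] P[of y] P[of z] P0 xyz by (auto simp: ph_def)
    then show ?thesis
      using later[OF True] ph[of x z] ph[of y z] xyz P0 by (auto simp: v_def)
  next
    case False
    then have lt: "\<beta> y < \<beta> x" using \<beta>_ne[of x y] xyz by auto
    have "ph x z < ph x y"
      using lt P[of y] P[of z] P0 xyz by (auto simp: ph_def)
    then show ?thesis
      using later[OF lt] ph[of x z] ph[of y z] xyz P0 by (auto simp: v_def)
  qed
  have sys: "crossing_system A (\<lambda>x. real (n x)) u"
  proof
    show "inj_on (\<lambda>x. real (n x)) A" using n by (auto simp: inj_on_def)
    show "u x y = u y x" for x y by (auto simp: u_def)
    fix x y z assume xyz: "x \<in> A" "y \<in> A" "z \<in> A" "real (n x) < real (n y)" "real (n y) < real (n z)"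
    then have "u x y = real_of_int (v x y)" "u y z = real_of_int (v y z)" "u x z = real_of_int (v x z)"
      by (auto simp: u_def)
    then show "u x y < u x z \<and> u x z < u y z \<or> u y z < u x z \<and> u x z < u x y \<or> u x y = u x z \<and> u x z = u y z"
      using key[of x y z] xyz by auto
  qed (use assms in auto)
  \<comment> \<open>The cutoff separates phase 0, below \<open>P / 2\<close>, from the other phases,
    which are at least \<open>P\<close>. Of the strings at later positions that outlive it,
    \<open>x\<close> thus meets exactly those with \<open>a y < b x\<close>.\<close>
  define m where "m x = real_of_int (4 * P * \<beta> x) + real_of_int P / 2" for x
  have half: "real_of_int i \<le> real_of_int P / 2 \<longleftrightarrow> 2 * i \<le> P" for i by linarith
  have *: "adj u m x y \<longleftrightarrow> overlap a b x y \<or> overlap a b y x"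
    if xy: "x \<in> A" "y \<in> A" "n x < n y" for x y
  proof -
    have "u x y \<le> m x \<longleftrightarrow> 2 * ph x y \<le> P"
      using xy(3) half[of "ph x y"] by (simp add: u_def v_def m_def)
    moreover have "2 * ph x y \<le> P \<longleftrightarrow> \<beta> x < \<beta> y \<and> a y < b x"
      using P[OF xy(2)] P0 by (auto simp: ph_def)
    moreover have "m x \<le> m y" if "\<beta> x < \<beta> y"
      using later[OF that] P0 unfolding m_def by linarith
    ultimately have "adj u m x y \<longleftrightarrow> \<beta> x < \<beta> y \<and> a y < b x"
      by (auto simp: adj_def)
    then show ?thesis using ord[OF xy] \<beta>[OF xy] by (auto simp: overlap_def)
  qed
  have "adj u m x y \<longleftrightarrow> overlap a b x y \<or> overlap a b y x" if xy: "x \<in> A" "y \<in> A" "x \<noteq> y" for x y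
  proof -
    have "n x < n y \<or> n y < n x" using n xy by (metis inj_onD linorder_neqE_nat)
    then show ?thesis using *[of x y] *[of y x] crossing_system.adj_sym[OF sys, of m x y] xy by blast
  qed
  then show ?thesis using sys by blast
qed

section \<open>The induction step and slot systems\<close>

text \<open>Clique number at most \<open>k\<close>, with \<open>c\<close> colors known for smaller
  clique number. \<open>IH\<close> quantifies over all crossing systems on the same element type,
  because it is applied to subsets of \<open>S\<close>, to shortened lengths, and to overlap systems
  that have their own positions and times.\<close>

locale chi_step = crossing_system S p t for S :: "'a set" and p t +
  fixes l :: "'a \<Rightarrow> real" and k c :: nat
  assumes k_pos: "0 < k" and cf: "clique_free (adj t l) S (Suc k)"
    and IH: "\<And>V q u m. crossing_system V q u \<Longrightarrow> clique_free (adj u m) V k \<Longrightarrow>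
      colorable (adj u m) (V :: 'a set) c"
begin

abbreviation E :: "'a \<Rightarrow> 'a \<Rightarrow> bool" where "E \<equiv> adj t l"

lemma E_sym: "E x y \<Longrightarrow> E y x"
  using adj_sym by blast

lemma E_clique_insert:
  assumes "C \<subseteq> S" "w \<in> S" "clique E C" "\<And>x. x \<in> C \<Longrightarrow> x \<noteq> w \<and> E x w"
  shows "card C < k"
proof -
  have "clique E (insert w C)" unfolding clique_def
  proof (intro ballI impI)
    fix x y assume "x \<in> insert w C" "y \<in> insert w C" "x \<noteq> y"
    then consider "x \<in> C" "y \<in> C" | "x \<in> C" "y = w" | "y \<in> C" "x = w" by blast
    then show "E x y"
      using assms(3,4) E_sym \<open>x \<noteq> y\<close> by cases (auto simp: clique_def)
  qed
  moreover have "insert w C \<subseteq> S" using assms(1,2) by simp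
  ultimately have "card (insert w C) < Suc k" using cf by (simp add: clique_free_def)
  moreover have "finite C" using finite assms(1) finite_subset by blast
  moreover have "w \<notin> C" using assms(4) by blast
  ultimately show ?thesis by simp
qed

lemma nbrs_colorable:
  assumes "A \<subseteq> S" "w \<in> S" "\<And>x. x \<in> A \<Longrightarrow> x \<noteq> w \<and> E x w"
  shows "colorable E A c"
proof (rule IH[OF subsystem[OF assms(1)]])
  show "clique_free E A k" unfolding clique_free_def
  proof (intro allI impI)
    fix C assume C: "C \<subseteq> A" "clique E C"
    show "card C < k"
      by (rule E_clique_insert[OF _ assms(2) C(2)]) (use C(1) assms(1,3) in auto)
  qed
qed

end

text \<open>
  Every \<open>x \<in> T\<close> spans the time slots \<open>i\<close> with \<open>\<alpha> x < i < \<gamma> x\<close>, and it is cut off at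
  time \<open>m x\<close>. An edge from \<open>x\<close> to a later \<open>y\<close> without a common slot is of shift type:
  \<open>y\<close> begins where \<open>x\<close> ends.
\<close>
locale slot_system = chi_step S p t l k c
  for S :: "'a set" and p t l k c +
  fixes T :: "'a set" and \<alpha> \<gamma> :: "'a \<Rightarrow> nat" and m :: "'a \<Rightarrow> real"
  assumes T: "T \<subseteq> S"
    and \<alpha>_mono: "x \<in> T \<Longrightarrow> y \<in> T \<Longrightarrow> p x < p y \<Longrightarrow> \<alpha> x \<le> \<alpha> y"
    and long: "x \<in> T \<Longrightarrow> \<alpha> x + 2 \<le> \<gamma> x"
    and edge: "x \<in> T \<Longrightarrow> y \<in> T \<Longrightarrow> p x < p y \<Longrightarrow> E x y \<Longrightarrow> \<alpha> x < \<alpha> y \<Longrightarrow> \<alpha> y \<le> \<gamma> x + 1"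
    and slot: "C \<subseteq> T \<Longrightarrow> clique E C \<Longrightarrow> (\<And>x. x \<in> C \<Longrightarrow> \<alpha> x < i \<and> i < \<gamma> x) \<Longrightarrow> C \<noteq> {} \<Longrightarrow> card C < k"
    and cut_le: "x \<in> T \<Longrightarrow> m x \<le> l x"
    and cut: "x \<in> T \<Longrightarrow> y \<in> T \<Longrightarrow> p x < p y \<Longrightarrow> adj t m x y \<Longrightarrow> \<alpha> x < \<alpha> y \<Longrightarrow> \<alpha> y + 1 < \<gamma> x"
    and bad: "x \<in> T \<Longrightarrow> y \<in> T \<Longrightarrow> z \<in> T \<Longrightarrow> p x < p y \<Longrightarrow> p y < p z \<Longrightarrow> E x z \<Longrightarrow> \<gamma> x \<le> \<alpha> z + 1 \<Longrightarrow>
      \<gamma> x + 3 \<le> \<gamma> y \<Longrightarrow> \<not> E x y \<Longrightarrow> adj t m y z"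
begin

text \<open>All members of a clique span the slot right after the start of its rightmost member, so
  \<open>slot\<close> bounds the clique and \<open>IH\<close> applies to the shortened
  strings.\<close>

lemma good_colorable:
  assumes A: "A \<subseteq> T" and n: "\<And>x. x \<in> A \<Longrightarrow> n x \<le> l x"
    and good: "\<And>x y. x \<in> A \<Longrightarrow> y \<in> A \<Longrightarrow> p x < p y \<Longrightarrow> adj t n x y \<Longrightarrow> \<alpha> x < \<alpha> y \<and> \<alpha> y + 1 < \<gamma> x"
  shows "colorable (adj t n) A c"
proof (rule IH)
  show "crossing_system A p t" using A T subsystem by blast
  show "clique_free (adj t n) A k" unfolding clique_free_def
  proof (intro allI impI)
    fix C assume C: "C \<subseteq> A" "clique (adj t n) C"
    show "card C < k"
    proof (cases "C = {}")
      case False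
      have fin: "finite C" using C A T finite finite_subset by metis
      then obtain z where z: "z \<in> C" "\<And>x. x \<in> C \<Longrightarrow> p x \<le> p z"
        using False ex_maximizer[of C p] by blast
      show ?thesis
      proof (rule slot)
        show "C \<subseteq> T" using C A by blast
        show "clique E C" using C A n unfolding clique_def adj_def by (meson order_trans subsetD)
        fix x assume x: "x \<in> C"
        show "\<alpha> x < \<alpha> z + 1 \<and> \<alpha> z + 1 < \<gamma> x"
        proof (cases "x = z")
          case True
          then show ?thesis using long[of z] z(1) C(1) A by fastforce
        next
          case False
          then have "p x < p z" using z(2)[OF x] pos_cases[of x z] x z(1) C(1) A T by fastforce
          moreover have "adj t n x z" using C(2) x z(1) False by (auto simp: clique_def)
          ultimately show ?thesis using good[of x z] x z(1) C(1) by fastforce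
        qed
      qed (use False in simp)
    qed (simp add: k_pos)
  qed
qed

lemma \<alpha>_less: "x \<in> T \<Longrightarrow> y \<in> T \<Longrightarrow> \<alpha> x < \<alpha> y \<Longrightarrow> p x < p y"
  using \<alpha>_mono pos_cases T by (metis in_mono less_irrefl not_less)

text \<open>The factors: 2 for having a shift edge to the right or not, \<open>c\<close> for the
  overlap graph of the arcs, 9 for the pairs of colors of arc ends, and \<open>c\<close> for the
  edges that remain once no shift edge does.\<close>

lemma residue_class_colorable:
  assumes A: "A \<subseteq> T" and same: "\<And>x y. x \<in> A \<Longrightarrow> y \<in> A \<Longrightarrow> x \<noteq> y \<Longrightarrow> E x y \<Longrightarrow> \<alpha> x \<noteq> \<alpha> y"
    and ind: "indep (adj t m) A"
    and res: "\<And>x. x \<in> A \<Longrightarrow> \<alpha> x mod 3 = \<rho>" "\<And>x. x \<in> A \<Longrightarrow> \<gamma> x mod 3 = \<sigma>"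
  shows "colorable E A (2 * (c * (9 * c)))"
proof -
  define shift where "shift x y \<longleftrightarrow> p x < p y \<and> E x y \<and> \<gamma> x \<le> \<alpha> y + 1" for x y
  have lt: "\<alpha> x < \<alpha> y" if "x \<in> A" "y \<in> A" "p x < p y" "E x y" for x y
    using same[of x y] \<alpha>_mono[of x y] that A by fastforce
  have good: "colorable E B c"
    if "B \<subseteq> A" "\<And>x y. x \<in> B \<Longrightarrow> y \<in> B \<Longrightarrow> \<not> shift x y" for B
  proof (rule good_colorable)
    fix x y assume xy: "x \<in> B" "y \<in> B" "p x < p y" "E x y"
    then show "\<alpha> x < \<alpha> y \<and> \<alpha> y + 1 < \<gamma> x"
      using lt[of x y] that unfolding shift_def by fastforce
  qed (use that A in auto)
  define lab where "lab x = (if \<exists>y\<in>A. shift x y then 1 else 0 :: nat)" for x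
  show ?thesis
  proof (rule colorable_label_refine[where g = lab])
    show "lab x < 2" for x by (auto simp: lab_def)
    fix i B assume B: "B \<subseteq> A" "\<And>x. x \<in> B \<Longrightarrow> lab x = i"
    show "colorable E B (c * (9 * c))"
    proof (cases "i = 1")
      case False
      then have "\<not> shift x y" if "x \<in> B" "y \<in> B" for x y
        using B that unfolding lab_def by (metis subsetD)
      then have "colorable E B c" using good B(1) by blast
      then show ?thesis by (rule colorable_mono) (cases c, auto)
    next
      case True
      have "\<forall>x\<in>B. \<exists>y\<in>A. shift x y" using B(2) True unfolding lab_def by (metis zero_neq_one)
      then obtain nb where nb: "\<And>x. x \<in> B \<Longrightarrow> nb x \<in> A \<and> shift x (nb x)" by metis
      \<comment> \<open>Residue \<rho> leaves a single value in the range from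
        \<open>\<gamma> x - 1\<close> to \<open>\<gamma> x + 1\<close>. So \<open>g x\<close> does
        not depend on the choice of \<open>nb x\<close>: every shift edge from \<open>x\<close> ends
        at a string that begins at \<open>g x\<close>.\<close>
      define g where "g x = \<alpha> (nb x)" for x
      have g: "\<alpha> x < g x" "\<gamma> x \<le> g x + 1" "g x \<le> \<gamma> x + 1" "g x mod 3 = \<rho>" if "x \<in> B" for x
      proof -
        have *: "nb x \<in> A" "p x < p (nb x)" "E x (nb x)" "\<gamma> x \<le> g x + 1"
          using nb[OF that] by (auto simp: shift_def g_def)
        show "\<alpha> x < g x" using lt[of x "nb x"] * that B(1) by (auto simp: g_def)
        then show "g x \<le> \<gamma> x + 1" using edge[of x "nb x"] * that A B(1) unfolding g_def by blast
        show "\<gamma> x \<le> g x + 1" "g x mod 3 = \<rho>" using * res(1) by (auto simp: g_def)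
      qed
      \<comment> \<open>Interlacing arcs force a crossing: otherwise \<open>bad\<close> makes
        \<open>y\<close> and \<open>nb x\<close> meet before their cuts, against independence in
        \<open>adj t m\<close>. The residues turn \<open>\<gamma> x < \<gamma> y\<close> into the
        gap of 3 that \<open>bad\<close> requires.\<close>
      have ov: "E x y" "\<alpha> y + 1 < \<gamma> x" if "x \<in> B" "y \<in> B" "overlap \<alpha> g x y" for x y
      proof -
        have o: "\<alpha> x < \<alpha> y" "\<alpha> y < g x" "g x < g y" using that(3) by (auto simp: overlap_def)
        have "x \<in> A" "y \<in> A" using that(1,2) B(1) by auto
        then have r: "\<alpha> y mod 3 = \<rho>" "\<gamma> x mod 3 = \<gamma> y mod 3" "g x mod 3 = g y mod 3"
          using res(1)[of y] res(2)[of x] res(2)[of y] g(4)[OF that(1)] g(4)[OF that(2)] by simp_all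
        have "\<alpha> y + 3 \<le> g x" using o(2) r(1) g(4)[OF that(1)] by (intro mod_3_gap) simp_all
        then show "\<alpha> y + 1 < \<gamma> x" using g(3)[OF that(1)] by linarith
        have "g x + 3 \<le> g y" using o(3) r(3) by (rule mod_3_gap[rotated])
        then have "\<gamma> x < \<gamma> y" using g(2)[OF that(1)] g(3)[OF that(2)] by linarith
        then have \<gamma>: "\<gamma> x + 3 \<le> \<gamma> y" using r(2) by (intro mod_3_gap)
        have z: "nb x \<in> A" "E x (nb x)" "\<gamma> x \<le> \<alpha> (nb x) + 1" using nb[OF that(1)] by (auto simp: shift_def)
        have xy: "x \<in> T" "y \<in> T" "nb x \<in> T" using that z(1) A B(1) by auto
        have p: "p x < p y" "p y < p (nb x)" using \<alpha>_less xy o by (auto simp: g_def)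
        show "E x y"
        proof (rule ccontr)
          assume "\<not> E x y"
          then have "adj t m y (nb x)" using bad[OF xy p z(2,3) \<gamma>] by blast
          then show False using ind that(2) z(1) B(1) p(2) unfolding indep_def by fastforce
        qed
      qed
      have "colorable (\<lambda>x y. overlap \<alpha> g x y \<or> overlap \<alpha> g y x) B c"
      proof -
        have "finite B" using B(1) A T finite finite_subset by metis
        from overlap_system[OF this, of \<alpha> g] obtain q u n where
          sys: "crossing_system B q u" and
          adj: "\<forall>x\<in>B. \<forall>y\<in>B. x \<noteq> y \<longrightarrow> (adj u n x y \<longleftrightarrow> overlap \<alpha> g x y \<or> overlap \<alpha> g y x)"
          by blast
        have "clique_free (adj u n) B k" unfolding clique_free_def
        proof (intro allI impI)
          fix C assume C: "C \<subseteq> B" "clique (adj u n) C"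
          have o: "overlap \<alpha> g x y \<or> overlap \<alpha> g y x" if "x \<in> C" "y \<in> C" "x \<noteq> y" for x y
          proof -
            have "adj u n x y" using C(2) that by (auto simp: clique_def)
            moreover have "x \<in> B" "y \<in> B" using C(1) that by auto
            ultimately show ?thesis using adj that(3) by blast
          qed
          show "card C < k"
          proof (cases "C = {}")
            case False
            have "finite C" using C(1) \<open>finite B\<close> finite_subset by blast
            then obtain z where z: "z \<in> C" "\<And>x. x \<in> C \<Longrightarrow> \<alpha> x \<le> \<alpha> z"
              using False ex_maximizer[of C \<alpha>] by blast
            show ?thesis
            proof (rule slot)
              show "C \<subseteq> T" using C B A by blast
              show "clique E C" unfolding clique_def
              proof (intro ballI impI)
                fix x y assume xy: "x \<in> C" "y \<in> C" "x \<noteq> y"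
                from o[OF this] show "E x y"
                proof
                  assume "overlap \<alpha> g x y" then show ?thesis using ov(1)[of x y] xy C(1) by blast
                next
                  assume "overlap \<alpha> g y x" then show ?thesis using ov(1)[of y x] E_sym xy C(1) by blast
                qed
              qed
              fix x assume x: "x \<in> C"
              show "\<alpha> x < \<alpha> z + 1 \<and> \<alpha> z + 1 < \<gamma> x"
              proof (cases "x = z")
                case True
                then show ?thesis using long[of z] z(1) C(1) A B(1) by fastforce
              next
                case False
                then have "overlap \<alpha> g x z" using o[OF x z(1)] z(2)[OF x] by (auto simp: overlap_def)
                then show ?thesis using ov(2)[of x z] x z C(1) by (auto simp: overlap_def)
              qed
            qed (use False in simp)
          qed (simp add: k_pos)
        qed
        from IH[OF sys this] show ?thesis by (rule colorable_cong) (use adj in auto)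
      qed
      then show ?thesis
      proof (rule colorable_refine)
        fix D assume D: "D \<subseteq> B" "indep (\<lambda>x y. overlap \<alpha> g x y \<or> overlap \<alpha> g y x) D"
        have "\<exists>\<psi> :: nat \<Rightarrow> nat. (\<forall>i. \<psi> i < 3) \<and> (\<forall>(a, b)\<in>(\<lambda>x. (\<alpha> x, g x)) ` D. \<psi> a \<noteq> \<psi> b)"
        proof (rule noncrossing_arcs)
          show "finite ((\<lambda>x. (\<alpha> x, g x)) ` D)" using D(1) B(1) A T finite finite_subset by (metis finite_imageI)
          show "a < b" if "(a, b) \<in> (\<lambda>x. (\<alpha> x, g x)) ` D" for a b using that g(1) D(1) by auto
          fix a b a' b'
          assume "(a, b) \<in> (\<lambda>x. (\<alpha> x, g x)) ` D" "(a', b') \<in> (\<lambda>x. (\<alpha> x, g x)) ` D"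
            "a < a'" "a' < b" "b < b'"
          then obtain x y where "x \<in> D" "y \<in> D" "overlap \<alpha> g x y" by (auto simp: overlap_def)
          moreover from this have "x \<noteq> y" by (auto simp: overlap_def)
          ultimately show False using D(2) by (auto simp: indep_def)
        qed
        then obtain \<psi> :: "nat \<Rightarrow> nat" where \<psi>: "\<And>i. \<psi> i < 3" "\<And>x. x \<in> D \<Longrightarrow> \<psi> (\<alpha> x) \<noteq> \<psi> (g x)"
          by auto
        show "colorable E D (9 * c)"
        \<comment> \<open>A shift edge from \<open>x\<close> to \<open>y\<close> has
          \<open>\<alpha> y = g x\<close>, so equal labels of \<open>x\<close> and \<open>y\<close>
          would give both ends of the arc of \<open>x\<close> the same color.\<close>
        proof (rule colorable_label_refine[where g = "\<lambda>x. 3 * \<psi> (\<alpha> x) + \<psi> (g x)"])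
          show "3 * \<psi> (\<alpha> x) + \<psi> (g x) < 9" for x using \<psi>(1)[of "\<alpha> x"] \<psi>(1)[of "g x"] by linarith
          fix i F assume F: "F \<subseteq> D" "\<And>x. x \<in> F \<Longrightarrow> 3 * \<psi> (\<alpha> x) + \<psi> (g x) = i"
          show "colorable E F c"
          proof (rule good)
            fix x y assume xy: "x \<in> F" "y \<in> F"
            show "\<not> shift x y"
            proof
              assume s: "shift x y"
              have xB: "x \<in> B" "y \<in> B" using xy F(1) D(1) by auto
              have "\<alpha> x < \<alpha> y" using s lt[of x y] xB B(1) by (auto simp: shift_def)
              then have "\<alpha> y \<le> \<gamma> x + 1" using s edge[of x y] xB B(1) A unfolding shift_def by blast
              moreover have "\<gamma> x \<le> \<alpha> y + 1" using s by (simp add: shift_def)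
              moreover have "\<alpha> y mod 3 = g x mod 3" using res(1) g(4) xB B(1) by auto
              ultimately have "\<alpha> y = g x"
                using g(2,3)[OF xB(1)] mod_3_gap[of "\<alpha> y" "g x"] mod_3_gap[of "g x" "\<alpha> y"] by linarith
              moreover have "3 * \<psi> (\<alpha> x) + \<psi> (g x) = 3 * \<psi> (\<alpha> y) + \<psi> (g y)" using F(2) xy by metis
              then have "\<psi> (\<alpha> x) = \<psi> (\<alpha> y)" using \<psi>(1)[of "g x"] \<psi>(1)[of "g y"] by linarith
              ultimately show False using \<psi>(2)[of x] xy F(1) by auto
            qed
          qed (use F D B in blast)
        qed
      qed
    qed
  qed
qed

text \<open>The factors in order: \<open>D\<close> removes the edges between strings with a common
  start, \<open>c\<close> the meetings before the cut times, which are good by \<open>cut\<close>,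
  and 3 and 3 fix the residues of \<alpha> and \<gamma>.\<close>

theorem slot_colorable:
  assumes fib: "\<And>i. colorable E {x \<in> T. \<alpha> x = i} D"
  shows "colorable E T (D * (c * (3 * (3 * (2 * (c * (9 * c)))))))"
proof (rule colorable_refine[OF colorable_fibers[of E T \<alpha> D, OF fib]])
  fix A assume A: "A \<subseteq> T" "indep (\<lambda>x y. E x y \<and> \<alpha> x = \<alpha> y) A"
  have "colorable (adj t m) A c"
  proof (rule good_colorable)
    fix x y assume xy: "x \<in> A" "y \<in> A" "p x < p y" "adj t m x y"
    then have "x \<noteq> y" "x \<in> T" "y \<in> T" using A(1) by auto
    then have "E x y" using cut_le[of x] cut_le[of y] xy(4) by (auto simp: adj_def)
    then have "\<alpha> x \<noteq> \<alpha> y" using A(2) xy(1,2) \<open>x \<noteq> y\<close> by (auto simp: indep_def)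
    then have "\<alpha> x < \<alpha> y" using \<alpha>_mono[of x y] xy A(1) by fastforce
    then show "\<alpha> x < \<alpha> y \<and> \<alpha> y + 1 < \<gamma> x" using cut[of x y] xy A(1) by auto
  qed (use A(1) cut_le in auto)
  then show "colorable E A (c * (3 * (3 * (2 * (c * (9 * c))))))"
  proof (rule colorable_refine)
    fix B assume B: "B \<subseteq> A" "indep (adj t m) B"
    show "colorable E B (3 * (3 * (2 * (c * (9 * c)))))"
    proof (rule colorable_label_refine[where g = "\<lambda>x. \<alpha> x mod 3"])
      fix i F assume F: "F \<subseteq> B" "\<And>x. x \<in> F \<Longrightarrow> \<alpha> x mod 3 = i"
      show "colorable E F (3 * (2 * (c * (9 * c))))"
      proof (rule colorable_label_refine[where g = "\<lambda>x. \<gamma> x mod 3"])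
        fix j G assume G: "G \<subseteq> F" "\<And>x. x \<in> G \<Longrightarrow> \<gamma> x mod 3 = j"
        show "colorable E G (2 * (c * (9 * c)))"
        proof (rule residue_class_colorable[where \<rho> = i and \<sigma> = j])
          show "G \<subseteq> T" using G(1) F(1) B(1) A(1) by blast
          have "G \<subseteq> A" using G(1) F(1) B(1) by blast
          then show "\<alpha> x \<noteq> \<alpha> y" if "x \<in> G" "y \<in> G" "x \<noteq> y" "E x y" for x y
            using A(2) that unfolding indep_def by blast
          have "G \<subseteq> B" using G(1) F(1) by blast
          then show "indep (adj t m) G" using B(2) unfolding indep_def by blast
          show "\<alpha> x mod 3 = i" "\<gamma> x mod 3 = j" if "x \<in> G" for x
            using F(2)[of x] G that by auto
        qed
      qed simp
    qed simp
  qed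
qed

end

section \<open>Supported families\<close>

context crossing_system
begin

text \<open>Topology enters here: until they meet, the outer strings and the ground enclose the
  middle string, which can leave only through one of them.\<close>

lemma between_min:
  "x \<in> S \<Longrightarrow> y \<in> S \<Longrightarrow> z \<in> S \<Longrightarrow> p x < p y \<Longrightarrow> p y < p z \<Longrightarrow> t x y \<le> t x z \<or> t y z \<le> t x z"
  using between[of x y z] by linarith

text \<open>Once the middle string has met both outer ones, these have changed sides and therefore
  have met.\<close>

lemma between_max:
  "x \<in> S \<Longrightarrow> y \<in> S \<Longrightarrow> z \<in> S \<Longrightarrow> p x < p y \<Longrightarrow> p y < p z \<Longrightarrow> t x z \<le> t x y \<or> t x z \<le> t y z"
  using between[of x y z] by linarith

end

definition slot_bound :: "nat \<Rightarrow> nat \<Rightarrow> nat" where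
  "slot_bound c D = D * (c * (3 * (3 * (2 * (c * (9 * c))))))"

text \<open>
  The strings of \<open>W\<close> are transversals from the ground to \<open>z\<close>: a string of \<open>T\<close> crosses
  consecutive members of \<open>W\<close> and never turns back.
\<close>
lemma (in chi_step) transversal_colorable:
  assumes T: "T \<subseteq> S" and W: "W \<subseteq> S" and z: "z \<in> S" and indW: "indep E W"
    and Wz: "\<And>w. w \<in> W \<Longrightarrow> E w z"
    and Tz: "\<And>x. x \<in> T \<Longrightarrow> \<not> E x z \<and> l x \<le> l z"
    and side: "(\<forall>x\<in>T \<union> W. p z < p x) \<or> (\<forall>x\<in>T \<union> W. p x < p z)"
    and sup: "\<And>x. x \<in> T \<Longrightarrow> \<exists>w\<in>W. p x < p w \<and> E x w"
  shows "colorable E T (slot_bound c c)"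
proof -
  have disj: "x \<noteq> w" if "x \<in> T" "w \<in> W" for x w using Wz Tz that by blast
  have zx: "t x z > l x" "t z x > l x" if "x \<in> T" for x
    using Tz[OF that] sym[of x z] by (auto simp: adj_def)
  have wz: "t w z \<le> l w" "t z w \<le> l w" if "w \<in> W" for w
    using Wz[OF that] sym[of w z] by (auto simp: adj_def)
  have WW: "t v w > l v \<or> t v w > l w" if "v \<in> W" "w \<in> W" "v \<noteq> w" for v w
    using indW that unfolding indep_def adj_def by fastforce
  have mem: "x \<in> S" if "x \<in> T \<or> x \<in> W" for x using that T W by blast
  \<comment> \<open>\<open>w\<close> reaches \<open>z\<close> and \<open>x\<close> does not, so
    \<open>w\<close> is still alive wherever \<open>x\<close> gets to it; only the length of
    \<open>x\<close> decides about the crossing.\<close>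
  have outlive_right: "E x w" if "x \<in> T" "w \<in> W" "p x < p w" "t x w \<le> l x" for x w
    using side
  proof
    assume "\<forall>x\<in>T \<union> W. p z < p x"
    then show ?thesis
      using between_min[of z x w] zx[OF that(1)] wz[OF that(2)] that z mem by (auto simp: adj_def)
  next
    assume "\<forall>x\<in>T \<union> W. p x < p z"
    then show ?thesis
      using between_max[of x w z] zx[OF that(1)] wz[OF that(2)] that z mem by (auto simp: adj_def)
  qed
  have outlive_left: "E w x" if "x \<in> T" "w \<in> W" "p w < p x" "t w x \<le> l x" for x w
    using side
  proof
    assume "\<forall>x\<in>T \<union> W. p z < p x"
    then show ?thesis
      using between_max[of z w x] zx[OF that(1)] wz[OF that(2)] that z mem by (auto simp: adj_def)
  next
    assume "\<forall>x\<in>T \<union> W. p x < p z"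
    then show ?thesis
      using between_min[of w x z] zx[OF that(1)] wz[OF that(2)] that z mem by (auto simp: adj_def)
  qed
  have contiguous: "E x v" if "x \<in> T" "v \<in> W" "w \<in> W" "p x < p v" "p v < p w" "E x w" for x v w
  proof (rule ccontr)
    assume "\<not> E x v"
    then have xv: "t x v > l x" using outlive_right that by fastforce
    have xw: "t x w \<le> l x" "t x w \<le> l w" using that(6) by (auto simp: adj_def)
    have vw: "t v w \<le> t x w" using between_min[of x v w] that mem xv xw by auto
    have "t v w \<le> l v"
      using side
    proof
      assume "\<forall>x\<in>T \<union> W. p z < p x"
      then show ?thesis
        using between_min[of z x v] zx[OF that(1)] wz[OF that(2)] that z mem xv xw vw by auto
    next
      assume "\<forall>x\<in>T \<union> W. p x < p z"
      then show ?thesis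
        using between_max[of x w z] between_min[of v w z] zx[OF that(1)] wz[OF that(2)] wz[OF that(3)]
          that z mem xw vw by auto
    qed
    then show False using WW[of v w] that vw xw by auto
  qed
  \<comment> \<open>A string that crosses \<open>w\<close> on its left and \<open>v\<close> on its
    right would force \<open>v\<close> and \<open>w\<close> to meet, against the independence of
    \<open>W\<close>.\<close>
  have no_left: "\<not> E w x" if "x \<in> T" "w \<in> W" "p w < p x" for x w
  proof
    assume wx: "E w x"
    obtain v where v: "v \<in> W" "p x < p v" "E x v" using sup \<open>x \<in> T\<close> by blast
    have le: "t w v \<le> l x"
      using between_max[of w x v] that v mem wx by (auto simp: adj_def)
    have "t w v \<le> l w \<and> t w v \<le> l v"
      using side
    proof
      assume "\<forall>x\<in>T \<union> W. p z < p x"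
      then show ?thesis
        using between_max[of z w x] between_min[of z w v] zx[OF that(1)] wz[OF that(2)] wz[OF v(1)]
          that v z mem wx le by (auto simp: adj_def)
    next
      assume "\<forall>x\<in>T \<union> W. p x < p z"
      then show ?thesis
        using between_max[of x v z] between_min[of w v z] zx[OF that(1)] wz[OF that(2)] wz[OF v(1)]
          that v z mem wx v le by (auto simp: adj_def)
    qed
    moreover have "w \<noteq> v" using that v by auto
    ultimately show False using WW[of w v] that v by auto
  qed
  have jumped: "E x w" if "x \<in> T" "y \<in> T" "w \<in> W" "p x < p w" "p w < p y" "E x y" for x y w
  proof -
    have "t w y > l y" using outlive_left[of y w] no_left[of y w] that by fastforce
    then show ?thesis
      using between_min[of x w y] that mem outlive_right[of x w] by (auto simp: adj_def)
  qed
  have later: "t x v \<le> t x w"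
    if "x \<in> T" "v \<in> W" "w \<in> W" "p x < p v" "p v < p w" "E x v" "E x w" for x v w
  proof -
    have "v \<noteq> w" using that by auto
    then show ?thesis using between_min[of x v w] WW[of v w] that mem by (auto simp: adj_def)
  qed
  obtain e where e: "bij_betw e W {..<card W}" and e_less: "\<And>v w. v \<in> W \<Longrightarrow> w \<in> W \<Longrightarrow> e v < e w \<longleftrightarrow> p v < p w"
    using order_index[of W p] finite_subset[OF W finite] inj_on_subset[OF inj W] by blast
  have e_le: "e v \<le> e w \<longleftrightarrow> p v \<le> p w" if "v \<in> W" "w \<in> W" for v w
    using e_less[of w v] that by (simp add: linorder_not_less[symmetric])
  have e_surj: "\<exists>w\<in>W. e w = j" if "j \<le> e v" "v \<in> W" for j v
  proof -
    have "e v < card W" using e that(2) by (auto simp: bij_betw_def)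
    then have "j < card W" using that(1) by simp
    then have "j \<in> e ` W" using e by (simp add: bij_betw_def)
    then show ?thesis by auto
  qed
  have "\<exists>nxt lst. nxt \<in> W \<and> lst \<in> W \<and> p x < p nxt \<and> p x < p lst \<and> E x nxt \<and> E x lst \<and>
      (\<forall>w\<in>W. p x < p w \<longrightarrow> e nxt \<le> e w) \<and> (\<forall>w\<in>W. E x w \<longrightarrow> e w \<le> e lst)" if x: "x \<in> T" for x
  proof -
    have fin: "finite W" using W finite finite_subset by blast
    obtain w where w: "w \<in> W" "p x < p w" "E x w" using sup x by blast
    obtain nxt where nxt: "nxt \<in> W" "p x < p nxt" "\<forall>w\<in>W. p x < p w \<longrightarrow> p nxt \<le> p w"
      using ex_maximizer[of "{w \<in> W. p x < p w}" "\<lambda>w. - p w"] fin w by auto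
    obtain lst where lst: "lst \<in> W" "E x lst" "\<forall>w\<in>W. E x w \<longrightarrow> p w \<le> p lst"
      using ex_maximizer[of "{w \<in> W. E x w}" p] fin w by auto
    have "E x nxt"
    proof (cases "nxt = w")
      case False
      then have "p nxt < p w" using nxt w pos_cases[of nxt w] mem by fastforce
      then show ?thesis using contiguous[of x nxt w] x nxt w by blast
    qed (use w in simp)
    moreover have "p x < p lst" using lst w by fastforce
    ultimately show ?thesis using nxt lst e_le by blast
  qed
  then have "\<forall>x\<in>T. \<exists>q. fst q \<in> W \<and> snd q \<in> W \<and> p x < p (fst q) \<and> p x < p (snd q) \<and>
      E x (fst q) \<and> E x (snd q) \<and> (\<forall>w\<in>W. p x < p w \<longrightarrow> e (fst q) \<le> e w) \<and>
      (\<forall>w\<in>W. E x w \<longrightarrow> e w \<le> e (snd q))" by (metis fst_conv snd_conv)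
  from bchoice[OF this] obtain q where q: "\<And>x. x \<in> T \<Longrightarrow> fst (q x) \<in> W \<and> snd (q x) \<in> W \<and>
      p x < p (fst (q x)) \<and> p x < p (snd (q x)) \<and> E x (fst (q x)) \<and> E x (snd (q x)) \<and>
      (\<forall>w\<in>W. p x < p w \<longrightarrow> e (fst (q x)) \<le> e w) \<and> (\<forall>w\<in>W. E x w \<longrightarrow> e w \<le> e (snd (q x)))"
    by blast
  define nxt where "nxt x = fst (q x)" for x
  define lst where "lst x = snd (q x)" for x
  have nxt: "\<And>x. x \<in> T \<Longrightarrow> nxt x \<in> W \<and> p x < p (nxt x) \<and> E x (nxt x)"
    and lst: "\<And>x. x \<in> T \<Longrightarrow> lst x \<in> W \<and> p x < p (lst x) \<and> E x (lst x)"
    and nxt_min: "\<And>x w. x \<in> T \<Longrightarrow> w \<in> W \<Longrightarrow> p x < p w \<Longrightarrow> e (nxt x) \<le> e w"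
    and lst_max: "\<And>x w. x \<in> T \<Longrightarrow> w \<in> W \<Longrightarrow> E x w \<Longrightarrow> e w \<le> e (lst x)"
    using q unfolding nxt_def lst_def by blast+
  have nxt_lst: "e (nxt x) \<le> e (lst x)" if "x \<in> T" for x
    using lst_max[of x "nxt x"] nxt that by blast
  have passes: "p x < p w \<and> E x w" if "x \<in> T" "w \<in> W" "e (nxt x) \<le> e w" "e w \<le> e (lst x)" for x w
  proof -
    have "p (nxt x) \<le> p w" using e_le[of "nxt x" w] nxt[OF that(1)] that by blast
    then have "p x < p w" using nxt[OF that(1)] by linarith
    moreover have "p w \<le> p (lst x)" using e_le[of w "lst x"] lst[OF that(1)] that by blast
    then have "w = lst x \<or> p w < p (lst x)" using pos_cases[of w "lst x"] mem lst[OF that(1)] that(2) by fastforce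
    ultimately show ?thesis using contiguous[of x w "lst x"] lst[OF that(1)] that by blast
  qed
  have edge0: "e (nxt y) \<le> e (lst x) + 1" if xy: "x \<in> T" "y \<in> T" "p x < p y" "E x y" for x y
  proof (rule ccontr)
    assume "\<not> ?thesis"
    then obtain w where w: "w \<in> W" "e w = e (lst x) + 1" "e w < e (nxt y)"
      using e_surj[of "e (lst x) + 1" "nxt y"] nxt[of y] xy(2) by auto
    have "p (lst x) < p w" using e_less[of "lst x" w] w lst xy(1) by auto
    then have "p x < p w" using lst[OF xy(1)] by linarith
    moreover have "\<not> p y < p w" using nxt_min[of y w] w xy(2) by auto
    then have "p w < p y" using pos_cases[of w y] disj[of y w] w xy(2) mem by auto
    ultimately have "E x w" using jumped xy w by blast
    then show False using lst_max[of x w] w xy(1) by simp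
  qed
  have m_ge: "t x w \<le> t x (lst x)" if "x \<in> T" "w \<in> W" "p x < p w" "E x w" for x w
  proof (cases "w = lst x")
    case False
    have L: "lst x \<in> W" "p x < p (lst x)" "E x (lst x)" using lst[OF that(1)] by auto
    have "p w < p (lst x)"
      using lst_max[OF that(1,2,4)] e_le[OF that(2) L(1)] pos_cases[of w "lst x"] False that(2) L(1) mem
      by fastforce
    then show ?thesis using later[of x w "lst x"] that L by blast
  qed simp
  \<comment> \<open>Slot \<open>i\<close> stands for the transversal with index
    \<open>i - 1\<close>: the slots strictly between \<alpha> and \<gamma> are the transversals from
    \<open>nxt x\<close> to \<open>lst x\<close>, hence the 2 in \<gamma>. The cut time is the
    crossing with the last transversal.\<close>
  define \<alpha> where "\<alpha> x = e (nxt x)" for x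
  define \<gamma> where "\<gamma> x = e (lst x) + 2" for x
  define m where "m x = t x (lst x)" for x
  interpret slot_system S p t l k c T \<alpha> \<gamma> m
  proof
    show "T \<subseteq> S" by (rule T)
    show "\<alpha> x \<le> \<alpha> y" if "x \<in> T" "y \<in> T" "p x < p y" for x y
      using nxt_min[of x "nxt y"] nxt[of y] that by (auto simp: \<alpha>_def)
    show "\<alpha> x + 2 \<le> \<gamma> x" if "x \<in> T" for x using nxt_lst[OF that] by (simp add: \<alpha>_def \<gamma>_def)
    show "m x \<le> l x" if "x \<in> T" for x using lst[OF that] by (auto simp: m_def adj_def)
    show "\<alpha> y \<le> \<gamma> x + 1" if "x \<in> T" "y \<in> T" "p x < p y" "E x y" "\<alpha> x < \<alpha> y" for x y
      using edge0[of x y] that by (simp add: \<alpha>_def \<gamma>_def)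
    show "card C < k" if C: "C \<subseteq> T" "clique E C" "\<And>x. x \<in> C \<Longrightarrow> \<alpha> x < i \<and> i < \<gamma> x" "C \<noteq> {}" for C i
    proof -
      obtain x0 where x0: "x0 \<in> C" using C(4) by blast
      have i: "e (nxt x) \<le> i - 1" "i - 1 \<le> e (lst x)" if "x \<in> C" for x
        using C(3)[OF that] by (auto simp: \<alpha>_def \<gamma>_def)
      obtain w where w: "w \<in> W" "e w = i - 1"
        using e_surj[of "i - 1" "lst x0"] i[OF x0] lst[of x0] x0 C(1) by blast
      show ?thesis
      proof (rule E_clique_insert[OF _ _ C(2)])
        show "C \<subseteq> S" "w \<in> S" using C(1) T W w by auto
        show "x \<noteq> w \<and> E x w" if "x \<in> C" for x
          using passes[of x w] i[OF that] w C(1) that disj by auto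
      qed
    qed
    \<comment> \<open>Otherwise \<open>y\<close> starts beyond \<open>lst x\<close> and never
      crosses it, so \<open>x\<close> can meet \<open>y\<close> only after \<open>lst x\<close>,
      where it is cut.\<close>
    show "\<alpha> y + 1 < \<gamma> x" if xy: "x \<in> T" "y \<in> T" "p x < p y" "adj t m x y" "\<alpha> x < \<alpha> y" for x y
    proof (rule ccontr)
      assume "\<not> \<alpha> y + 1 < \<gamma> x"
      then have lt: "e (lst x) < e (nxt y)" by (simp add: \<alpha>_def \<gamma>_def)
      have L: "lst x \<in> W" "p x < p (lst x)" using lst[OF xy(1)] by auto
      have "\<not> p y < p (lst x)" using nxt_min[OF xy(2) L(1)] lt by auto
      then have py: "p (lst x) < p y" using pos_cases[of "lst x" y] disj[OF xy(2) L(1)] L xy(2) mem by auto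
      have "t (lst x) y > l y" using outlive_left[OF xy(2) L(1) py] no_left[OF xy(2) L(1) py] by fastforce
      moreover have "t x y \<le> l y" "t x y \<le> t x (lst x)"
        using xy(4) lst[OF xy(2)] by (auto simp: adj_def m_def)
      ultimately show False using between[of x "lst x" y] L py xy mem by auto
    qed
    \<comment> \<open>The transversal following \<open>lst x\<close> is \<open>nxt z'\<close>;
      \<open>x\<close> stops short of it, while \<open>y\<close> and \<open>z'\<close> reach it. To
      meet \<open>x\<close> before that, \<open>z'\<close> has to cross \<open>y\<close>, which
      starts between them, and it does so before either is cut.\<close>
    show "adj t m y z'" if xyz: "x \<in> T" "y \<in> T" "z' \<in> T" "p x < p y" "p y < p z'" "E x z'"
       "\<gamma> x \<le> \<alpha> z' + 1" "\<gamma> x + 3 \<le> \<gamma> y" "\<not> E x y" for x y z'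
    proof -
      have N: "nxt z' \<in> W" "p z' < p (nxt z')" "E z' (nxt z')" using nxt[OF xyz(3)] by auto
      have ew: "e (nxt z') = e (lst x) + 1"
        using edge0[of x z'] xyz by (simp add: \<alpha>_def \<gamma>_def)
      have ny: "E y (nxt z')"
        using passes[of y "nxt z'"] nxt_min[of y "nxt z'"] N xyz ew by (auto simp: \<gamma>_def)
      have nx: "t x (nxt z') > l x"
        using lst_max[of x "nxt z'"] outlive_right[of x "nxt z'"] N xyz ew by fastforce
      have xz: "t x z' \<le> l x" "t x z' \<le> l z'" using xyz(6) by (auto simp: adj_def)
      have 1: "t x z' < t z' (nxt z')"
        using between_max[of x z' "nxt z'"] nx xz N xyz mem by auto
      have yw: "t y (nxt z') \<le> l y" using ny by (simp add: adj_def)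
      have nxy: "t x y > l x \<or> t x y > l y" using xyz(9) by (auto simp: adj_def)
      have 2: "t y z' \<le> t x z'"
        using between_min[of x y z'] between_min[of y z' "nxt z'"] 1 xz yw nxy N xyz mem by auto
      have "t y z' \<le> t y (nxt z')"
        using between_min[of y z' "nxt z'"] 1 2 N xyz mem by auto
      then have "t y z' \<le> m y" using m_ge[of y "nxt z'"] N ny xyz by (auto simp: m_def)
      moreover have "t y z' \<le> m z'" using m_ge[of z' "nxt z'"] N 1 2 xyz by (auto simp: m_def)
      ultimately show ?thesis by (simp add: adj_def)
    qed
  qed
  show ?thesis unfolding slot_bound_def
  proof (rule slot_colorable)
    fix i
    show "colorable E {x \<in> T. \<alpha> x = i} c"
    proof (cases "{x \<in> T. \<alpha> x = i} = {}")
      case False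
      then obtain x0 where x0: "x0 \<in> T" "\<alpha> x0 = i" by blast
      have same: "nxt x = nxt x0" if "x \<in> T" "\<alpha> x = i" for x
        using e that x0 nxt[of x] nxt[of x0] by (auto simp: \<alpha>_def bij_betw_def inj_on_def)
      show ?thesis
      proof (rule nbrs_colorable)
        show "nxt x0 \<in> S" using nxt[OF x0(1)] W by blast
        show "x \<noteq> nxt x0 \<and> E x (nxt x0)" if "x \<in> {x \<in> T. \<alpha> x = i}" for x
          using nxt[of x] disj[of x "nxt x"] same[of x] that by auto
      qed (use T in blast)
    qed (simp only: colorable_empty)
  qed
qed

text \<open>
  The strings of \<open>W\<close> enter the region of \<open>T\<close> through \<open>u\<close>, like rungs of various lengths
  above each other; \<open>e\<close> counts the rungs from below. By \<open>skip\<close>, a string that avoids a rung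
  below its highest one crosses every later string on that rung. Hence a slot, being a group of
  rungs whose strings need many colors, has a rung that a whole clique passing the slot crosses.
\<close>
lemma (in chi_step) ladder_colorable:
  assumes T: "T \<subseteq> S" and W: "W \<subseteq> S" and u: "u \<in> S" and indW: "indep E W"
    and Wu: "\<And>w. w \<in> W \<Longrightarrow> p w < p u \<and> E w u"
    and Tu: "\<And>x. x \<in> T \<Longrightarrow> p u < p x \<and> \<not> E x u \<and> l x \<le> l u"
    and sup: "\<And>x. x \<in> T \<Longrightarrow> \<exists>w\<in>W. E w x"
  shows "colorable E T (Suc k * (5 * ((k + 3) * c) + slot_bound c ((k + 3) * c)))"
proof -
  have mem: "x \<in> S" if "x \<in> T \<or> x \<in> W" for x using that T W by blast
  have finT: "finite T" using T finite finite_subset by blast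
  have wx: "p w < p x" "w \<noteq> x" if "w \<in> W" "x \<in> T" for w x using Wu[OF that(1)] Tu[OF that(2)] by auto
  have WW: "t v w > l v \<or> t v w > l w" if "v \<in> W" "w \<in> W" "v \<noteq> w" for v w
    using indW that unfolding indep_def adj_def by fastforce
  have skip: "E s x"
    if "s \<in> T" "x \<in> T" "p s < p x" "v \<in> W" "w \<in> W" "p v < p w" "E v s" "E w x" "\<not> E w s" for s x v w
  proof -
    have a: "t v s \<le> l v" "t v s \<le> l s" "t w x \<le> l w" "t w x \<le> l x" "t w s > l w \<or> t w s > l s"
      "t v w > l v \<or> t v w > l w"
      using that WW[of v w] by (auto simp: adj_def)
    have lw: "l w < t w s" using between_min[of v w s] a that wx mem by auto
    have sx: "t s x \<le> t w x" using between_min[of w s x] a lw that wx mem by auto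
    have "t s x \<le> l s" using between_min[of v w s] a lw sx that wx mem by auto
    then show ?thesis using sx a by (simp add: adj_def)
  qed
  \<comment> \<open>The order is reversed: the rung nearest to \<open>u\<close> is the lowest
    one.\<close>
  obtain e where e: "bij_betw e W {..<card W}" and e_less: "\<And>v w. v \<in> W \<Longrightarrow> w \<in> W \<Longrightarrow> e v < e w \<longleftrightarrow> p w < p v"
    using order_index[of W "\<lambda>w. - p w"] finite_subset[OF W finite] inj_on_subset[OF inj W]
    by (auto simp: inj_on_def)
  have "\<exists>lo hi. lo \<in> W \<and> hi \<in> W \<and> E lo x \<and> E hi x \<and> (\<forall>w\<in>W. E w x \<longrightarrow> e lo \<le> e w \<and> e w \<le> e hi)"
    if x: "x \<in> T" for x
  proof -
    have fin: "finite {w \<in> W. E w x}" using W finite finite_subset[of "{w \<in> W. E w x}" S] by auto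
    have ne: "{w \<in> W. E w x} \<noteq> {}" using sup[OF x] by blast
    obtain hi where "hi \<in> W" "E hi x" "\<forall>w\<in>W. E w x \<longrightarrow> e w \<le> e hi"
      using ex_maximizer[OF fin ne, of e] by auto
    moreover obtain lo where "lo \<in> W" "E lo x" "\<forall>w\<in>W. E w x \<longrightarrow> e lo \<le> e w"
      using ex_maximizer[OF fin ne, of "\<lambda>w. - int (e w)"] by auto
    ultimately show ?thesis by blast
  qed
  then have "\<forall>x\<in>T. \<exists>q. fst q \<in> W \<and> snd q \<in> W \<and> E (fst q) x \<and> E (snd q) x \<and>
      (\<forall>w\<in>W. E w x \<longrightarrow> e (fst q) \<le> e w \<and> e w \<le> e (snd q))" by (metis fst_conv snd_conv)
  from bchoice[OF this] obtain q where q: "\<And>x. x \<in> T \<Longrightarrow> fst (q x) \<in> W \<and> snd (q x) \<in> W \<and>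
      E (fst (q x)) x \<and> E (snd (q x)) x \<and> (\<forall>w\<in>W. E w x \<longrightarrow> e (fst (q x)) \<le> e w \<and> e w \<le> e (snd (q x)))"
    by blast
  define lo where "lo x = fst (q x)" for x
  define hi where "hi x = snd (q x)" for x
  have lo: "\<And>x. x \<in> T \<Longrightarrow> lo x \<in> W \<and> E (lo x) x"
    and hi: "\<And>x. x \<in> T \<Longrightarrow> hi x \<in> W \<and> E (hi x) x"
    and lo_min: "\<And>x w. x \<in> T \<Longrightarrow> w \<in> W \<Longrightarrow> E w x \<Longrightarrow> e (lo x) \<le> e w"
    and hi_max: "\<And>x w. x \<in> T \<Longrightarrow> w \<in> W \<Longrightarrow> E w x \<Longrightarrow> e w \<le> e (hi x)"
    using q unfolding lo_def hi_def by blast+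
  \<comment> \<open>If the lowest rung drops as the position grows, the two strings cross by
    \<open>skip\<close>. Coloring this strict order leaves classes in which the lowest rung is
    monotone in the position.\<close>
  define R where "R x y \<longleftrightarrow> p x < p y \<and> e (lo y) < e (lo x)" for x y
  have R_E: "E x y" if "x \<in> T" "y \<in> T" "R x y" for x y
  proof (rule skip)
    show "p x < p y" "p (lo x) < p (lo y)" "E (lo x) x" "E (lo y) y" "lo x \<in> W" "lo y \<in> W"
      using that lo[of x] lo[of y] e_less[of "lo y" "lo x"] by (auto simp: R_def)
    show "\<not> E (lo y) x" using lo_min[of x "lo y"] lo[of y] that by (auto simp: R_def)
  qed (use that in auto)
  have "colorable (\<lambda>x y. R x y \<or> R y x) T (Suc k)"
  proof (rule colorable_height[OF finT])
    show "R x z" if "R x y" "R y z" for x y z using that by (auto simp: R_def)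
    show "\<not> R x x" for x by (simp add: R_def)
    show "clique_free (\<lambda>x y. R x y \<or> R y x) T (Suc k)" unfolding clique_free_def
    proof (intro allI impI)
      fix C assume C: "C \<subseteq> T" "clique (\<lambda>x y. R x y \<or> R y x) C"
      have "E x y" if "x \<in> C" "y \<in> C" "x \<noteq> y" for x y
        using C that R_E[of x y] R_E[of y x] E_sym[of y x] unfolding clique_def by blast
      then have "clique E C" by (simp add: clique_def)
      then show "card C < Suc k" using cf C(1) T unfolding clique_free_def by blast
    qed
  qed
  then show ?thesis
  proof (rule colorable_refine)
    fix T' assume T': "T' \<subseteq> T" "indep (\<lambda>x y. R x y \<or> R y x) T'"
    \<comment> \<open>\<open>D\<close> pays for the neighborhoods of \<open>k + 2\<close> strings,
      so a chunk that is not \<open>D\<close>-colorable contains a string that avoids a whole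
      clique, or both ends of an edge.\<close>
    define D where "D = (k + 2) * c"
    have Dc: "D + c = (k + 3) * c" by (simp add: D_def algebra_simps)
    have lo_mono: "e (lo x) \<le> e (lo y)" if "x \<in> T'" "y \<in> T'" "p x < p y" for x y
      using T'(2) that unfolding indep_def R_def by (metis less_irrefl not_less)
    have lo_less: "p x < p y" if "x \<in> T'" "y \<in> T'" "e (lo x) < e (lo y)" for x y
    proof -
      have "\<not> p y < p x" "x \<noteq> y" using lo_mono[of y x] that by auto
      then show ?thesis using pos_cases[of x y] that T'(1) mem by auto
    qed
    have nbr: "colorable E {x \<in> T'. x \<noteq> v \<and> E x v} c" if "v \<in> S" for v
      by (rule nbrs_colorable[OF _ that]) (use T' T in auto)
    have "colorable E {x \<in> T'. e (lo x) = j} c" for j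
    proof (cases "{x \<in> T'. e (lo x) = j} = {}")
      case False
      then obtain x0 where x0: "x0 \<in> T'" "e (lo x0) = j" by blast
      have "lo x = lo x0" if "x \<in> T'" "e (lo x) = j" for x
      proof -
        have "lo x \<in> W" "lo x0 \<in> W" using lo that(1) x0(1) T'(1) by auto
        then show ?thesis using inj_onD[OF bij_betw_imp_inj_on[OF e], of "lo x" "lo x0"] that(2) x0(2) by simp
      qed
      then have "{x \<in> T'. e (lo x) = j} \<subseteq> {x \<in> T'. x \<noteq> lo x0 \<and> E x (lo x0)}"
        using lo wx T'(1) E_sym by fastforce
      then show ?thesis using colorable_subset nbr[of "lo x0"] lo[of x0] x0 T'(1) mem by blast
    qed (simp only: colorable_empty)
    from chunks[OF finite_subset[OF T'(1) finT] this, of D]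
    obtain \<sigma> :: "nat \<Rightarrow> nat" where \<sigma>: "mono \<sigma>"
      and \<sigma>_col: "\<And>i. colorable E {x \<in> T'. \<sigma> (e (lo x)) = i} (D + c)"
      and \<sigma>_big: "\<And>i j. i < \<sigma> j \<Longrightarrow> \<not> colorable E {x \<in> T'. \<sigma> (e (lo x)) = i} D"
      by blast
    have \<sigma>_less: "i < j" if "\<sigma> i < \<sigma> j" for i j
      using monoD[OF \<sigma>, of j i] that by (meson leD leI)
    define \<alpha> where "\<alpha> x = \<sigma> (e (lo x))" for x
    define \<gamma> where "\<gamma> x = \<sigma> (e (hi x))" for x
    have gap: "E s x" if "s \<in> T'" "x \<in> T'" "e (lo s) < e (lo x)" "e (lo x) < e (hi s)" "\<not> E (lo x) s" for s x
    proof (rule skip)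
      show "p s < p x" using lo_less that by blast
      show "p (hi s) < p (lo x)" using e_less[of "lo x" "hi s"] lo hi that T'(1) by blast
    qed (use that lo hi T'(1) in blast)+
    \<comment> \<open>If every lowest rung from chunk \<open>i\<close> missed some member of
      \<open>C\<close>, then by \<open>gap\<close> the strings of the chunk would all be neighbors
      of members of \<open>C\<close>, and \<open>D\<close> colors would do.\<close>
    have common: "\<exists>x\<in>T'. \<alpha> x = i \<and> (\<forall>s\<in>C. E (lo x) s)"
      if C: "C \<subseteq> T'" "C \<noteq> {}" "card C \<le> k + 2" "\<And>s. s \<in> C \<Longrightarrow> \<alpha> s < i \<and> i < \<gamma> s" for C i
    proof (rule ccontr)
      assume no: "\<not> ?thesis"
      have "{x \<in> T'. \<alpha> x = i} \<subseteq> (\<Union>s\<in>C. {x \<in> T'. x \<noteq> s \<and> E x s})"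
      proof
        fix x assume "x \<in> {x \<in> T'. \<alpha> x = i}"
        then have x: "x \<in> T'" "\<alpha> x = i" by auto
        then obtain s where s: "s \<in> C" "\<not> E (lo x) s" using no by blast
        have "e (lo s) < e (lo x)" "e (lo x) < e (hi s)"
          using C(4)[OF s(1)] x(2) \<sigma>_less by (auto simp: \<alpha>_def \<gamma>_def)
        then have "E s x" "s \<noteq> x" using gap[of s x] s C(1) x(1) by auto
        then show "x \<in> (\<Union>s\<in>C. {x \<in> T'. x \<noteq> s \<and> E x s})" using s(1) x(1) E_sym by blast
      qed
      moreover have "colorable E (\<Union>s\<in>C. {x \<in> T'. x \<noteq> s \<and> E x s}) (card C * c)"
      proof (rule colorable_UN)
        show "finite C" using C(1) T'(1) finT by (meson finite_subset)
        show "colorable E {x \<in> T'. x \<noteq> s \<and> E x s} c" if "s \<in> C" for s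
          using nbr[of s] that C(1) T'(1) T by blast
      qed
      moreover have "card C * c \<le> D" unfolding D_def using C(3) by (rule mult_le_mono1)
      ultimately have "colorable E {x \<in> T'. \<alpha> x = i} D" by (meson colorable_mono colorable_subset)
      moreover obtain s where "s \<in> C" using C(2) by blast
      ultimately show False using \<sigma>_big[of i "e (hi s)"] C(4)[of s] by (simp add: \<alpha>_def \<gamma>_def)
    qed
    \<comment> \<open>A string \<open>v\<close> of a chunk in between has to cross \<open>x\<close>
      or \<open>y\<close>. Otherwise it is trapped under the edge \<open>x y\<close>, and its lowest
      rung, coming from the left, reaches it only through \<open>x\<close>, all of whose rungs are
      lower.\<close>
    have edge: "\<alpha> y \<le> \<gamma> x + 1" if xy: "x \<in> T'" "y \<in> T'" "p x < p y" "E x y" for x y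
    proof (rule ccontr)
      assume "\<not> ?thesis"
      then have i: "\<gamma> x < \<gamma> x + 1" "\<gamma> x + 1 < \<alpha> y" by auto
      have "{v \<in> T'. \<alpha> v = \<gamma> x + 1} \<subseteq> {v \<in> T'. v \<noteq> x \<and> E v x} \<union> {v \<in> T'. v \<noteq> y \<and> E v y}"
      proof
        fix v assume "v \<in> {v \<in> T'. \<alpha> v = \<gamma> x + 1}"
        then have v: "v \<in> T'" "\<sigma> (e (hi x)) < \<sigma> (e (lo v))" "\<sigma> (e (lo v)) < \<sigma> (e (lo y))"
          using i by (auto simp: \<alpha>_def \<gamma>_def)
        have xT: "x \<in> T" "y \<in> T" "v \<in> T" using xy v T'(1) by auto
        have "e (lo x) \<le> e (hi x)" using lo_min[of x "hi x"] hi[of x] xT by blast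
        moreover have hv: "e (hi x) < e (lo v)" using \<sigma>_less v(2) by blast
        ultimately have "e (lo x) < e (lo v)" by linarith
        then have p: "p x < p v" "p v < p y" using lo_less[of x v] lo_less[of v y] \<sigma>_less v xy by blast+
        have w: "lo v \<in> W" "E (lo v) v" "\<not> E (lo v) x" using lo[of v] hi_max[of x "lo v"] hv xT by auto
        have "E v x \<or> E v y"
        proof (rule ccontr)
          assume "\<not> ?thesis"
          then have "t x v > l x \<or> t x v > l v" "t v y > l v \<or> t v y > l y"
            using sym[of v x] by (auto simp: adj_def)
          moreover have "t x y \<le> l x" "t x y \<le> l y" using xy(4) by (auto simp: adj_def)
          moreover have "t (lo v) v \<le> l (lo v)" "t (lo v) v \<le> l v" "t (lo v) x > l (lo v) \<or> t (lo v) x > l x"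
            using w by (auto simp: adj_def)
          ultimately show False
            using between_min[of x v y] between_min[of "lo v" x v] p wx w(1) xT mem by auto
        qed
        then show "v \<in> {v \<in> T'. v \<noteq> x \<and> E v x} \<union> {v \<in> T'. v \<noteq> y \<and> E v y}" using v(1) p by auto
      qed
      moreover have "colorable E ({v \<in> T'. v \<noteq> x \<and> E v x} \<union> {v \<in> T'. v \<noteq> y \<and> E v y}) (c + c)"
        by (rule colorable_Un) (use nbr xy T'(1) T in blast)+
      moreover have "c + c \<le> D" by (simp add: D_def)
      ultimately have "colorable E {v \<in> T'. \<alpha> v = \<gamma> x + 1} D" by (meson colorable_mono colorable_subset)
      then show False using \<sigma>_big[of "\<gamma> x + 1" "e (lo y)"] i by (simp add: \<alpha>_def)
    qed
    have \<alpha>_mono': "\<alpha> x \<le> \<alpha> y" if "x \<in> T'" "y \<in> T'" "p x < p y" for x y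
      using lo_mono[OF that] monoD[OF \<sigma>] by (simp add: \<alpha>_def)
    \<comment> \<open>An edge from a string outside \<open>L\<close> raises \<alpha> by at most 4,
      so residues mod 5 confine the edges to equal \<alpha>. Inside \<open>L\<close>, the bound 4
      leaves room for a rung two chunks below the top.\<close>
    define L where "L = {x \<in> T'. \<alpha> x + 4 \<le> \<gamma> x}"
    have "colorable E (T' - L) (5 * (D + c))"
    proof (rule colorable_label_refine[where g = "\<lambda>x. \<alpha> x mod 5"])
      fix i A assume A: "A \<subseteq> T' - L" "\<And>x. x \<in> A \<Longrightarrow> \<alpha> x mod 5 = i"
      show "colorable E A (D + c)"
      proof (rule colorable_components[where g = \<alpha>])
        fix j
        show "colorable E {x \<in> A. \<alpha> x = j} (D + c)"
          by (rule colorable_subset[OF \<sigma>_col[of j]]) (use A(1) in \<open>auto simp: \<alpha>_def\<close>)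
      next
        have *: "\<alpha> x = \<alpha> y" if xy: "x \<in> A" "y \<in> A" "p x < p y" "E x y" for x y
        proof -
          have "\<alpha> x \<le> \<alpha> y" "\<alpha> y \<le> \<gamma> x + 1" using \<alpha>_mono'[of x y] edge[of x y] xy A(1) by auto
          moreover have "\<gamma> x < \<alpha> x + 4" using xy(1) A(1) by (auto simp: L_def)
          moreover have "\<alpha> x mod 5 = \<alpha> y mod 5" using A(2) xy by simp
          then have "5 dvd \<alpha> y - \<alpha> x" using \<open>\<alpha> x \<le> \<alpha> y\<close> mod_eq_dvd_iff_nat[of "\<alpha> x" "\<alpha> y" 5] by simp
          then have "\<alpha> y - \<alpha> x = 0 \<or> 5 \<le> \<alpha> y - \<alpha> x" using dvd_imp_le by blast
          ultimately show ?thesis by linarith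
        qed
        fix x y assume xy: "x \<in> A" "y \<in> A" "x \<noteq> y" "E x y"
        then have "p x < p y \<or> p y < p x" using pos_cases[of x y] A(1) T'(1) mem by blast
        then show "\<alpha> x = \<alpha> y" using *[of x y] *[of y x] xy E_sym by auto
      qed
    qed simp
    moreover have "colorable E L (slot_bound c (D + c))"
    proof -
      \<comment> \<open>The cut rung lies in chunk \<open>\<gamma> x - 2\<close>: low enough for
        \<open>cut\<close>, where \<open>\<alpha> y \<le> \<gamma> x - 2\<close> is the goal, and
        high enough for \<open>bad\<close>, where both \<open>\<gamma> y - 2\<close> and
        \<open>\<gamma> z - 2\<close> exceed \<open>\<gamma> x\<close>, so that the cut rungs of
        \<open>y\<close> and \<open>z\<close> miss \<open>x\<close>.\<close>
      have "\<exists>w\<in>W. E w x \<and> \<sigma> (e w) = \<gamma> x - 2" if "x \<in> L" for x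
      proof -
        have x: "x \<in> T'" "\<alpha> x + 4 \<le> \<gamma> x" using that by (auto simp: L_def)
        have "\<exists>y\<in>T'. \<alpha> y = \<gamma> x - 2 \<and> (\<forall>s\<in>{x}. E (lo y) s)"
          by (rule common) (use x in auto)
        then obtain y where "y \<in> T'" "\<alpha> y = \<gamma> x - 2" "E (lo y) x" by blast
        then show ?thesis using lo[of y] T'(1) unfolding \<alpha>_def by blast
      qed
      then obtain wc where wc: "\<And>x. x \<in> L \<Longrightarrow> wc x \<in> W \<and> E (wc x) x \<and> \<sigma> (e (wc x)) = \<gamma> x - 2" by metis
      define m where "m x = t (wc x) x" for x
      have LT: "x \<in> T'" "x \<in> T" "x \<in> S" "\<alpha> x + 4 \<le> \<gamma> x" if "x \<in> L" for x
        using that T'(1) T by (auto simp: L_def)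
      have high: "\<not> E w x" if "x \<in> L" "w \<in> W" "\<gamma> x < \<sigma> (e w)" for x w
        using hi_max[of x w] that LT[OF that(1)] monoD[OF \<sigma>, of "e w" "e (hi x)"] by (auto simp: \<gamma>_def)
      interpret slot_system S p t l k c L \<alpha> \<gamma> m
      proof
        show "L \<subseteq> S" using LT by blast
        show "\<alpha> x \<le> \<alpha> y" if "x \<in> L" "y \<in> L" "p x < p y" for x y using \<alpha>_mono' LT that by blast
        show "\<alpha> x + 2 \<le> \<gamma> x" if "x \<in> L" for x using LT[OF that] by simp
        show "\<alpha> y \<le> \<gamma> x + 1" if "x \<in> L" "y \<in> L" "p x < p y" "E x y" "\<alpha> x < \<alpha> y" for x y
          using edge LT that by blast
        show "m x \<le> l x" if "x \<in> L" for x using wc[OF that] by (auto simp: m_def adj_def)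
        show "card C < k" if C: "C \<subseteq> L" "clique E C" "\<And>x. x \<in> C \<Longrightarrow> \<alpha> x < i \<and> i < \<gamma> x" "C \<noteq> {}" for C i
        proof -
          have "C \<subseteq> S" using C(1) LT by blast
          then have "card C < Suc k" using cf C(2) by (auto simp: clique_free_def)
          then obtain x where x: "x \<in> T'" "\<forall>s\<in>C. E (lo x) s"
          proof -
            have "C \<subseteq> T'" using C(1) LT by blast
            moreover have "card C \<le> k + 2" using \<open>card C < Suc k\<close> by simp
            ultimately show ?thesis using common[OF _ C(4) _ C(3)] that by blast
          qed
          show ?thesis
          proof (rule E_clique_insert[OF \<open>C \<subseteq> S\<close> _ C(2)])
            show "lo x \<in> S" using lo x(1) T'(1) W by blast
            show "s \<noteq> lo x \<and> E s (lo x)" if "s \<in> C" for s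
              using x lo[of x] wx[of "lo x" s] that C(1) LT[of s] T'(1) E_sym by blast
          qed
        qed
        show "\<alpha> y + 1 < \<gamma> x" if xy: "x \<in> L" "y \<in> L" "p x < p y" "adj t m x y" "\<alpha> x < \<alpha> y" for x y
        proof -
          have V: "wc x \<in> W" "E (wc x) x" "\<sigma> (e (wc x)) = \<gamma> x - 2" using wc[OF xy(1)] by auto
          have Y: "lo y \<in> W" "E (lo y) y" using lo LT[OF xy(2)] by auto
          have "e (lo y) \<le> e (wc x)"
          proof (rule ccontr)
            assume "\<not> ?thesis"
            then have lt: "e (wc x) < e (lo y)" by simp
            then have pw: "p (lo y) < p (wc x)" using e_less V Y by blast
            have "lo y \<noteq> wc x" using pw by auto
            moreover have "\<not> E (wc x) y" using lo_min[of y "wc x"] lt V LT[OF xy(2)] by auto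
            moreover have "t (wc x) x \<le> l (wc x)" "t x y \<le> t (wc x) x"
              using V xy(4) by (auto simp: adj_def m_def)
            moreover have "t (lo y) y \<le> l (lo y)" "t (lo y) y \<le> l y" using Y by (auto simp: adj_def)
            ultimately show False
              using between_max[of "wc x" x y] between_min[of "lo y" "wc x" y] WW[of "lo y" "wc x"] V Y pw
                wx LT[OF xy(1)] LT[OF xy(2)] xy(3) mem by (auto simp: adj_def)
          qed
          then have "\<alpha> y \<le> \<gamma> x - 2" using monoD[OF \<sigma>] V(3) unfolding \<alpha>_def by metis
          then show ?thesis using LT[OF xy(1)] by linarith
        qed
        show "adj t m y z" if xyz: "x \<in> L" "y \<in> L" "z \<in> L" "p x < p y" "p y < p z" "E x z"
          "\<gamma> x \<le> \<alpha> z + 1" "\<gamma> x + 3 \<le> \<gamma> y" "\<not> E x y" for x y z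
        proof -
          have Y: "wc y \<in> W" "t (wc y) y \<le> l (wc y)" "t (wc y) y \<le> l y" "\<not> E (wc y) x"
            using wc[OF xyz(2)] high[OF xyz(1), of "wc y"] xyz(8) LT[OF xyz(2)] by (auto simp: adj_def)
          have Z: "wc z \<in> W" "t (wc z) z \<le> l (wc z)" "t (wc z) z \<le> l z" "\<not> E (wc z) x"
            using wc[OF xyz(3)] high[OF xyz(1), of "wc z"] xyz(7) LT[OF xyz(3)] by (auto simp: adj_def)
          have xz: "t x z \<le> l x" "t x z \<le> l z" using xyz(6) by (auto simp: adj_def)
          have nxy: "t x y > l x \<or> t x y > l y" using xyz(9) by (auto simp: adj_def)
          have nYx: "t (wc y) x > l (wc y) \<or> t (wc y) x > l x" and nZx: "t (wc z) x > l (wc z) \<or> t (wc z) x > l x"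
            using Y Z by (auto simp: adj_def)
          have S: "x \<in> S" "y \<in> S" "z \<in> S" "wc y \<in> S" "wc z \<in> S" "p (wc y) < p x" "p (wc z) < p x"
            using LT xyz Y Z wx mem by auto
          have 1: "t x z \<le> t (wc z) z"
            using between_min[of "wc z" x z] S xyz xz nZx Z by auto
          have 2: "t y z \<le> t x z"
            using between_min[of x y z] between_min[of "wc y" x y] S xyz xz nxy nYx Y by auto
          have 3: "t y z \<le> t (wc y) y"
            using between_min[of "wc y" x y] 2 S xyz xz nxy nYx Y by auto
          show ?thesis using 1 2 3 by (auto simp: adj_def m_def)
        qed
      qed
      show ?thesis unfolding slot_bound_def
      proof (rule slot_colorable)
        fix i
        show "colorable E {x \<in> L. \<alpha> x = i} (D + c)"
          by (rule colorable_subset[OF \<sigma>_col[of i]]) (use LT in \<open>auto simp: \<alpha>_def\<close>)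
      qed
    qed
    ultimately have "colorable E (T' - L \<union> L) (5 * (D + c) + slot_bound c (D + c))"
      by (rule colorable_Un)
    then show "colorable E T' (5 * ((k + 3) * c) + slot_bound c ((k + 3) * c))"
      unfolding Dc by (rule colorable_subset) blast
  qed
qed

section \<open>Breadth-first layers\<close>

text \<open>Cut the order greedily into chunks that need more than \<open>n\<close> colors, except
  the last. No edge spans a whole chunk, so edges stay within a chunk or join consecutive ones, and
  the parity of the chunk finishes.\<close>

lemma edge_interval_colorable:
  fixes p :: "'a \<Rightarrow> real"
  assumes "finite A" "inj_on p A" and sym: "\<And>x y. E x y \<Longrightarrow> E y x"
    and int: "\<And>u v. u \<in> A \<Longrightarrow> v \<in> A \<Longrightarrow> p u < p v \<Longrightarrow> E u v \<Longrightarrow> colorable E {x \<in> A. p u < p x \<and> p x < p v} n"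
  shows "colorable E A (2 * (n + 1))"
proof -
  obtain e where e: "bij_betw e A {..<card A}" and e_less: "\<And>x y. x \<in> A \<Longrightarrow> y \<in> A \<Longrightarrow> e x < e y \<longleftrightarrow> p x < p y"
    using order_index[OF assms(1,2)] by blast
  have "colorable E {x \<in> A. e x = j} 1" for j
  proof (cases "{x \<in> A. e x = j} = {}")
    case False
    then obtain x where x: "x \<in> A" "e x = j" by blast
    have "{x \<in> A. e x = j} \<subseteq> {x}" using x e by (auto simp: bij_betw_def inj_on_def)
    then show ?thesis by (rule colorable_subset[OF colorable_singleton])
  qed (simp only: colorable_empty)
  from chunks[OF assms(1) this, of n] obtain \<sigma> :: "nat \<Rightarrow> nat" where \<sigma>: "mono \<sigma>"
    and col: "\<And>i. colorable E {x \<in> A. \<sigma> (e x) = i} (n + 1)"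
    and big: "\<And>i j. i < \<sigma> j \<Longrightarrow> \<not> colorable E {x \<in> A. \<sigma> (e x) = i} n" by blast
  have \<sigma>_less: "i < j" if "\<sigma> i < \<sigma> j" for i j
    using monoD[OF \<sigma>, of j i] that by (meson leD leI)
  have near: "\<sigma> (e x) \<le> \<sigma> (e y) \<and> \<sigma> (e y) \<le> \<sigma> (e x) + 1" if xy: "x \<in> A" "y \<in> A" "p x < p y" "E x y" for x y
  proof
    show "\<sigma> (e x) \<le> \<sigma> (e y)" using e_less[of x y] xy by (intro monoD[OF \<sigma>]) auto
    show "\<sigma> (e y) \<le> \<sigma> (e x) + 1"
    proof (rule ccontr)
      assume far: "\<not> \<sigma> (e y) \<le> \<sigma> (e x) + 1"
      have "{v \<in> A. \<sigma> (e v) = \<sigma> (e x) + 1} \<subseteq> {v \<in> A. p x < p v \<and> p v < p y}"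
      proof
        fix v assume "v \<in> {v \<in> A. \<sigma> (e v) = \<sigma> (e x) + 1}"
        then have v: "v \<in> A" "\<sigma> (e v) = \<sigma> (e x) + 1" by auto
        then have "e x < e v" "e v < e y" using far \<sigma>_less[of "e x" "e v"] \<sigma>_less[of "e v" "e y"] by auto
        then show "v \<in> {v \<in> A. p x < p v \<and> p v < p y}" using e_less[of x v] e_less[of v y] xy v by auto
      qed
      then have "colorable E {v \<in> A. \<sigma> (e v) = \<sigma> (e x) + 1} n"
        by (rule colorable_subset[OF int[OF xy]])
      then show False using big[of "\<sigma> (e x) + 1" "e y"] far by simp
    qed
  qed
  show ?thesis
  proof (rule colorable_label_refine[where g = "\<lambda>x. \<sigma> (e x) mod 2"])
    fix i B assume B: "B \<subseteq> A" "\<And>x. x \<in> B \<Longrightarrow> \<sigma> (e x) mod 2 = i"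
    show "colorable E B (n + 1)"
    proof (rule colorable_components[where g = "\<lambda>x. \<sigma> (e x)"])
      show "colorable E {x \<in> B. \<sigma> (e x) = j} (n + 1)" for j
        by (rule colorable_subset[OF col[of j]]) (use B(1) in auto)
      have *: "\<sigma> (e x) = \<sigma> (e y)" if "x \<in> B" "y \<in> B" "p x < p y" "E x y" for x y
      proof -
        have "x \<in> A" "y \<in> A" using that B(1) by auto
        then have "\<sigma> (e x) = \<sigma> (e y) \<or> \<sigma> (e y) = Suc (\<sigma> (e x))" using near[of x y] that(3,4) by auto
        moreover have "\<sigma> (e x) mod 2 = \<sigma> (e y) mod 2" using B(2) that by simp
        ultimately show ?thesis by (auto simp: mod_Suc split: if_splits)
      qed
      fix x y assume xy: "x \<in> B" "y \<in> B" "x \<noteq> y" "E x y"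
      then have "p x \<noteq> p y" using B(1) inj_onD[OF assms(2), of x y] by auto
      then have "p x < p y \<or> p y < p x" by linarith
      then show "\<sigma> (e x) = \<sigma> (e y)" using *[of x y] *[of y x] xy sym[of x y] by auto
    qed
  qed simp
qed

section \<open>Strings trapped under an edge and their supports\<close>

text \<open>The sum of the transversal and the ladder bound, so that one number serves every type of
  support.\<close>

definition support_bound :: "nat \<Rightarrow> nat \<Rightarrow> nat" where
  "support_bound k c = slot_bound c c + Suc k * (5 * ((k + 3) * c) + slot_bound c ((k + 3) * c))"

text \<open>Between the ends of an edge, the neighbors of each end cost \<open>c\<close> and the
  trapped strings the third summand; \<open>edge_interval_colorable\<close> turns \<open>n\<close>
  into \<open>2 * (n + 1)\<close>.\<close>

definition layer_bound :: "nat \<Rightarrow> nat \<Rightarrow> nat" where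
  "layer_bound k c = 2 * (c + c + 6 * (c * support_bound k c) + 1)"

context chi_step
begin

lemma mirror_step: "chi_step S (\<lambda>x. - p x) t l k c"
  by (intro chi_step.intro mirror chi_step_axioms.intro k_pos cf IH)

text \<open>Until they meet, \<open>u\<close> and \<open>v\<close> form a cage with the ground, and
  \<open>x\<close> crosses neither, so it dies inside.\<close>

lemma trapped_short:
  assumes "u \<in> S" "v \<in> S" "x \<in> S" "p u < p x" "p x < p v" "E u v" "\<not> E x u" "\<not> E x v"
  shows "l x < t u v"
  using between_min[of u x v] assms sym[of x u] by (auto simp: adj_def)

text \<open>A string from outside would have to enter the cage of \<open>u\<close> and
  \<open>v\<close> through one of them to reach \<open>x\<close>.\<close>

lemma trapped_nbr:
  assumes uv: "u \<in> S" "v \<in> S" "E u v" and x: "x \<in> S" "p u < p x" "p x < p v" "\<not> E x u" "\<not> E x v"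
    and y: "y \<in> S" "E y x" "\<not> E y u" "\<not> E y v"
  shows "p u < p y \<and> p y < p v"
proof -
  have lx: "l x < t u v" by (rule trapped_short) (use uv x in auto)
  have luv: "t u v \<le> l u" "t u v \<le> l v" using uv(3) by (auto simp: adj_def)
  have yx: "t x y \<le> l x" "t x y \<le> l y" "t y x = t x y" using y(2) sym[of x y] by (auto simp: adj_def)
  have ne: "y \<noteq> u" "y \<noteq> v" using y x E_sym by blast+
  have "\<not> p v < p y"
    using between_min[of x v y] lx luv yx x y uv E_sym[of v y] E_sym[of v x] sym[of y v] by (auto simp: adj_def)
  moreover have "\<not> p y < p u"
    using between_min[of y u x] lx luv yx x y uv E_sym[of u y] E_sym[of u x] sym[of x u] by (auto simp: adj_def)
  ultimately show ?thesis using pos_cases[of y u] pos_cases[of y v] ne y(1) uv by blast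
qed

text \<open>A support that crosses \<open>u\<close> either starts to the left of \<open>u\<close>
  and acts as a rung, or starts to the right of \<open>u\<close> and is a transversal ending on
  \<open>u\<close>; likewise for \<open>v\<close> after reflection. Reflection also serves
  transversals that start to the left of the strings they support.\<close>

lemma trapped_colorable:
  assumes uv: "u \<in> S" "v \<in> S" "E u v" and T: "T \<subseteq> S"
    and trap: "\<And>x. x \<in> T \<Longrightarrow> p u < p x \<and> p x < p v \<and> \<not> E x u \<and> \<not> E x v"
    and sup: "\<And>x. x \<in> T \<Longrightarrow> \<exists>y\<in>S. E y x \<and> (E y u \<or> E y v)"
  shows "colorable E T (6 * (c * support_bound k c))"
proof -
  interpret m: chi_step S "\<lambda>x. - p x" t l k c by (rule mirror_step)
  have "\<forall>x\<in>T. \<exists>y. y \<in> S \<and> E y x \<and> (E y u \<or> E y v)" using sup by blast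
  from bchoice[OF this] obtain s where s: "\<And>x. x \<in> T \<Longrightarrow> s x \<in> S \<and> E (s x) x \<and> (E (s x) u \<or> E (s x) v)"
    by blast
  have ne: "s x \<noteq> u" "s x \<noteq> v" "s x \<noteq> x" if "x \<in> T" for x
    using s[OF that] trap[OF that] E_sym[of "s x" x] by auto
  have l: "l x \<le> l u" "l x \<le> l v" if "x \<in> T" for x
    using trapped_short[of u v x] trap[OF that] uv T that by (auto simp: adj_def)
  have nbr: "\<exists>f. f ` {x \<in> S. x \<noteq> z \<and> E x z} \<subseteq> {..<c} \<and>
      (\<forall>x\<in>{x \<in> S. x \<noteq> z \<and> E x z}. \<forall>y\<in>{x \<in> S. x \<noteq> z \<and> E x z}. E x y \<longrightarrow> x \<noteq> y \<longrightarrow> f x \<noteq> f y)"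
    if "z \<in> S" for z
  proof -
    have "colorable E {x \<in> S. x \<noteq> z \<and> E x z} c" by (rule nbrs_colorable[OF _ that]) auto
    then show ?thesis unfolding colorable_def .
  qed
  \<comment> \<open>The supports lie in the neighborhood of \<open>z\<close>, which has a
    \<open>c\<close>-coloring. Grouping strings by the color of their support makes the supports of
    each group independent.\<close>
  have split: "colorable E A (c * support_bound k c)"
    if z: "z \<in> S" and A: "A \<subseteq> T" "\<And>x. x \<in> A \<Longrightarrow> E (s x) z \<and> s x \<noteq> z"
      and ind: "\<And>B. B \<subseteq> A \<Longrightarrow> indep E (s ` B) \<Longrightarrow> colorable E B (support_bound k c)" for z A
  proof -
    obtain f where f: "f ` {x \<in> S. x \<noteq> z \<and> E x z} \<subseteq> {..<c}"
      "\<forall>x\<in>{x \<in> S. x \<noteq> z \<and> E x z}. \<forall>y\<in>{x \<in> S. x \<noteq> z \<and> E x z}. E x y \<longrightarrow> x \<noteq> y \<longrightarrow> f x \<noteq> f y"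
      using nbr[OF z] by (elim exE conjE)
    show ?thesis
    proof (rule colorable_label_refine[where g = "\<lambda>x. f (s x)"])
      show "f (s x) < c" if "x \<in> A" for x
      proof -
        have "s x \<in> {x \<in> S. x \<noteq> z \<and> E x z}" using s[of x] A(1) A(2)[OF that] that by auto
        then show ?thesis using f(1) by auto
      qed
      fix i B assume B: "B \<subseteq> A" "\<And>x. x \<in> B \<Longrightarrow> f (s x) = i"
      show "colorable E B (support_bound k c)"
      proof (rule ind[OF B(1)], unfold indep_def, intro ballI impI notI)
        fix a b assume ab: "a \<in> s ` B" "b \<in> s ` B" "a \<noteq> b" "E a b"
        then obtain x y where xy: "x \<in> B" "a = s x" "y \<in> B" "b = s y" by blast
        then have "f a = f b" using B(2) by simp
        moreover have "a \<in> S" "b \<in> S" "a \<noteq> z" "b \<noteq> z" "E a z" "E b z"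
          using xy s[of x] s[of y] A(1) A(2)[of x] A(2)[of y] B(1) by auto
        ultimately show False using f(2) ab(3,4) by simp
      qed
    qed
  qed
  have le: "slot_bound c c \<le> support_bound k c"
    "Suc k * (5 * ((k + 3) * c) + slot_bound c ((k + 3) * c)) \<le> support_bound k c"
    by (simp_all add: support_bound_def)
  \<comment> \<open>Types 0 and 3 are the ladders at \<open>u\<close> and \<open>v\<close>; in the
    other types the support is a transversal, starting to the left of \<open>x\<close> in types 1
    and 5 and to its right in types 2 and 4.\<close>
  define type where "type x = (if E (s x) u then if p (s x) < p u then 0 else if p (s x) < p x then 1 else 2
    else if p v < p (s x) then 3 else if p x < p (s x) then 4 else 5 :: nat)" for x
  show ?thesis
  proof (rule colorable_label_refine[where g = type])
    show "type x < 6" for x by (simp add: type_def)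
    fix i A assume A: "A \<subseteq> T" "\<And>x. x \<in> A \<Longrightarrow> type x = i"
    have AS: "s ` B \<subseteq> S" "B \<subseteq> S" if "B \<subseteq> A" for B using that A(1) s T by auto
    have lt: "p (s x) < p x \<or> p x < p (s x)" "p (s x) < p u \<or> p u < p (s x)" "p (s x) < p v \<or> p v < p (s x)"
      if "x \<in> A" for x
    proof -
      have "x \<in> T" "x \<in> S" using that A(1) T by auto
      then show "p (s x) < p x \<or> p x < p (s x)" "p (s x) < p u \<or> p u < p (s x)" "p (s x) < p v \<or> p v < p (s x)"
        using pos_cases[of "s x" x] pos_cases[of "s x" u] pos_cases[of "s x" v] s[of x] ne[of x] uv by auto
    qed
    have sA: "E (s x) x" "E x (s x)" if "x \<in> A" for x
      using s[of x] that A(1) E_sym[of "s x" x] by auto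
    have trapA: "p u < p x" "p x < p v" "\<not> E x u" "\<not> E x v" "l x \<le> l u" "l x \<le> l v"  if "x \<in> A" for x
      using trap[of x] l[of x] that A(1) by auto
    show "colorable E A (c * support_bound k c)"
    proof (cases "i \<le> 2")
      case True
      have su: "E (s x) u" if "x \<in> A" for x
        using A(2)[OF that] True by (auto simp: type_def split: if_splits)
      show ?thesis
      proof (rule split[OF uv(1) A(1)])
        show "E (s x) u \<and> s x \<noteq> u" if "x \<in> A" for x using su[OF that] ne(1)[of x] A(1) that by auto
        fix B assume B: "B \<subseteq> A" "indep E (s ` B)"
        consider "i = 0" | "i = 1" | "i = 2" using True by linarith
        then show "colorable E B (support_bound k c)"
        proof cases
          case 1
          have "p (s x) < p u" if "x \<in> B" for x
            using A(2)[of x] that B(1) 1 by (auto simp: type_def split: if_splits)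
          then have "colorable E B (Suc k * (5 * ((k + 3) * c) + slot_bound c ((k + 3) * c)))"
          proof (intro ladder_colorable[of B "s ` B" u])
            show "\<exists>w\<in>s ` B. E w x" if "x \<in> B" for x
              by (rule bexI[of _ "s x"]) (use that B(1) sA in auto)
          qed (use AS[OF B(1)] uv(1) B su trapA sA in auto)
          then show ?thesis by (rule colorable_mono[OF _ le(2)])
        next
          case 2
          have pos: "p u < p (s x) \<and> p (s x) < p x" if "x \<in> B" for x
          proof -
            have x: "x \<in> A" using that B(1) by blast
            have "\<not> p (s x) < p u" "p (s x) < p x"
              using A(2)[OF x] unfolding 2 type_def by (auto split: if_splits)
            then show ?thesis using lt(2)[OF x] by blast
          qed
          have "colorable E B (slot_bound c c)"
          proof (rule m.transversal_colorable[of B "s ` B" u])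
            show "\<exists>w\<in>s ` B. - p x < - p w \<and> E x w" if "x \<in> B" for x
              by (rule bexI[of _ "s x"]) (use that B(1) sA[of x] pos[of x] in auto)
            show "(\<forall>x\<in>B \<union> s ` B. - p u < - p x) \<or> (\<forall>x\<in>B \<union> s ` B. - p x < - p u)"
              by (rule disjI2) (use pos trapA(1,2) B(1) in \<open>auto simp: subset_iff\<close>)
          qed (use AS[OF B(1)] uv(1) B su trapA(3,5) in auto)
          then show ?thesis by (rule colorable_mono[OF _ le(1)])
        next
          case 3
          have pos: "p u < p (s x) \<and> p x < p (s x)" if "x \<in> B" for x
          proof -
            have x: "x \<in> A" using that B(1) by blast
            have "\<not> p (s x) < p u" "\<not> p (s x) < p x"
              using A(2)[OF x] unfolding 3 type_def by (auto split: if_splits)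
            then show ?thesis using lt(1,2)[OF x] by blast
          qed
          have "colorable E B (slot_bound c c)"
          proof (rule transversal_colorable[of B "s ` B" u])
            show "\<exists>w\<in>s ` B. p x < p w \<and> E x w" if "x \<in> B" for x
              by (rule bexI[of _ "s x"]) (use that B(1) sA[of x] pos[of x] in auto)
            show "(\<forall>x\<in>B \<union> s ` B. p u < p x) \<or> (\<forall>x\<in>B \<union> s ` B. p x < p u)"
              by (rule disjI1) (use pos trapA(1,2) B(1) in \<open>auto simp: subset_iff\<close>)
          qed (use AS[OF B(1)] uv(1) B su trapA(3,5) in auto)
          then show ?thesis by (rule colorable_mono[OF _ le(1)])
        qed
      qed
    next
      case False
      have sv: "E (s x) v" if "x \<in> A" for x
        using A(2)[OF that] s[of x] that A(1) False by (auto simp: type_def split: if_splits)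
      show ?thesis
      proof (rule split[OF uv(2) A(1)])
        show "E (s x) v \<and> s x \<noteq> v" if "x \<in> A" for x using sv[OF that] ne(2)[of x] A(1) that by auto
        fix B assume B: "B \<subseteq> A" "indep E (s ` B)"
        have "i < 6" if "x \<in> B" for x
        proof -
          have "type x = i" using A(2) that B(1) by blast
          moreover have "type x < 6" by (simp add: type_def)
          ultimately show ?thesis by simp
        qed
        then consider "B = {}" | "i = 3" | "i = 4" | "i = 5" using False by fastforce
        then show "colorable E B (support_bound k c)"
        proof cases
          case 2
          have "- p (s x) < - p v" if "x \<in> B" for x
            using A(2)[of x] that B(1) 2 by (auto simp: type_def split: if_splits)
          moreover have "- p v < - p x" if "x \<in> B" for x using trapA that B(1) by auto
          ultimately have "colorable E B (Suc k * (5 * ((k + 3) * c) + slot_bound c ((k + 3) * c)))"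
          proof (intro m.ladder_colorable[of B "s ` B" v])
            show "\<exists>w\<in>s ` B. E w x" if "x \<in> B" for x
              by (rule bexI[of _ "s x"]) (use that B(1) sA in auto)
          qed (use AS[OF B(1)] uv(2) B sv trapA(4,6) sA in auto)
          then show ?thesis by (rule colorable_mono[OF _ le(2)])
        next
          case 3
          have pos: "p (s x) < p v \<and> p x < p (s x)" if "x \<in> B" for x
          proof -
            have x: "x \<in> A" using that B(1) by blast
            have "\<not> p v < p (s x)" "p x < p (s x)"
              using A(2)[OF x] unfolding 3 type_def by (auto split: if_splits)
            then show ?thesis using lt(3)[OF x] by blast
          qed
          have "colorable E B (slot_bound c c)"
          proof (rule transversal_colorable[of B "s ` B" v])
            show "\<exists>w\<in>s ` B. p x < p w \<and> E x w" if "x \<in> B" for x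
              by (rule bexI[of _ "s x"]) (use that B(1) sA[of x] pos[of x] in auto)
            show "(\<forall>x\<in>B \<union> s ` B. p v < p x) \<or> (\<forall>x\<in>B \<union> s ` B. p x < p v)"
              by (rule disjI2) (use pos trapA(1,2) B(1) in \<open>auto simp: subset_iff\<close>)
          qed (use AS[OF B(1)] uv(2) B sv trapA(4,6) in auto)
          then show ?thesis by (rule colorable_mono[OF _ le(1)])
        next
          case 4
          have pos: "p (s x) < p v \<and> p (s x) < p x" if "x \<in> B" for x
          proof -
            have x: "x \<in> A" using that B(1) by blast
            have "\<not> p v < p (s x)" "\<not> p x < p (s x)"
              using A(2)[OF x] unfolding 4 type_def by (auto split: if_splits)
            then show ?thesis using lt(1,3)[OF x] by blast
          qed
          have "colorable E B (slot_bound c c)"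
          proof (rule m.transversal_colorable[of B "s ` B" v])
            show "\<exists>w\<in>s ` B. - p x < - p w \<and> E x w" if "x \<in> B" for x
              by (rule bexI[of _ "s x"]) (use that B(1) sA[of x] pos[of x] in auto)
            show "(\<forall>x\<in>B \<union> s ` B. - p v < - p x) \<or> (\<forall>x\<in>B \<union> s ` B. - p x < - p v)"
              by (rule disjI1) (use pos trapA(1,2) B(1) in \<open>auto simp: subset_iff\<close>)
          qed (use AS[OF B(1)] uv(2) B sv trapA(4,6) in auto)
          then show ?thesis by (rule colorable_mono[OF _ le(1)])
        qed simp
      qed
    qed
  qed
qed

text \<open>
  The coloring is done along breadth-first layers from the leftmost string of each component.
  A string of a layer that is trapped under an edge \<open>u v\<close> of the same layer has its parent
  crossing \<open>u\<close> or \<open>v\<close>, since otherwise the whole path to the root would be trapped.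
\<close>
theorem step_colorable: "colorable E S (2 * layer_bound k c)"
proof -
  define r where "r = {(x, y). x \<in> S \<and> y \<in> S \<and> E x y}"
  \<comment> \<open>The choice depends only on which strings reach \<open>x\<close>, so adjacent
    strings have literally the same root.\<close>
  define root where "root x = (SOME z. (z, x) \<in> r\<^sup>* \<and> (\<forall>y. (y, x) \<in> r\<^sup>* \<longrightarrow> p z \<le> p y))" for x
  define d where "d x = (LEAST n. (root x, x) \<in> r ^^ n)" for x
  have sym_r: "(y, x) \<in> r" if "(x, y) \<in> r" for x y using that E_sym by (auto simp: r_def)
  have root: "(root x, x) \<in> r\<^sup>* \<and> (\<forall>y. (y, x) \<in> r\<^sup>* \<longrightarrow> p (root x) \<le> p y)" if "x \<in> S" for x
  proof -
    have "{y. (y, x) \<in> r\<^sup>*} \<subseteq> S"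
    proof
      fix y assume "y \<in> {y. (y, x) \<in> r\<^sup>*}"
      then have "(y, x) \<in> r\<^sup>*" by simp
      then show "y \<in> S" using that by (cases rule: converse_rtranclE) (auto simp: r_def)
    qed
    then have "finite {y. (y, x) \<in> r\<^sup>*}" using finite finite_subset by blast
    then have "\<exists>z\<in>{y. (y, x) \<in> r\<^sup>*}. \<forall>y\<in>{y. (y, x) \<in> r\<^sup>*}. - p y \<le> - p z"
      by (rule ex_maximizer) blast
    then have "\<exists>z. (z, x) \<in> r\<^sup>* \<and> (\<forall>y. (y, x) \<in> r\<^sup>* \<longrightarrow> p z \<le> p y)" by auto
    then show ?thesis unfolding root_def by (rule someI_ex)
  qed
  have root_eq: "root x = root y" if "(x, y) \<in> r" for x y
  proof -
    have "(z, x) \<in> r\<^sup>* \<longleftrightarrow> (z, y) \<in> r\<^sup>*" for z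
      using that sym_r[OF that] by (meson rtrancl.rtrancl_into_rtrancl)
    then show ?thesis by (simp add: root_def)
  qed
  have d: "(root x, x) \<in> r ^^ d x" if "x \<in> S" for x
    using root[OF that] unfolding d_def by (metis LeastI_ex rtrancl_imp_relpow)
  have d_le: "d x \<le> n" if "(root x, x) \<in> r ^^ n" for x n
    unfolding d_def using that by (rule Least_le)
  have d_step: "d y \<le> d x + 1" if "(x, y) \<in> r" for x y
  proof -
    have "x \<in> S" using that by (simp add: r_def)
    then have "(root y, y) \<in> r ^^ Suc (d x)" using d[of x] that root_eq[OF that] by (auto simp: relcomp_def)
    then show ?thesis using d_le by fastforce
  qed
  have d_parent: "\<exists>y. (y, x) \<in> r \<and> d y + 1 = d x" if x: "x \<in> S" "d x > 0" for x
  proof -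
    obtain n where n: "d x = Suc n" using x(2) gr0_implies_Suc by blast
    then have "(root x, x) \<in> r ^^ Suc n" using d[OF x(1)] by simp
    then obtain y where y: "(root x, y) \<in> r ^^ n" "(y, x) \<in> r" by auto
    then have "d y \<le> n" using d_le[of y n] root_eq[OF y(2)] by simp
    moreover have "d x \<le> d y + 1" using d_step y(2) by blast
    ultimately show ?thesis using y(2) n by auto
  qed
  have d_0: "root x = x" if "x \<in> S" "d x = 0" for x
    using d[OF that(1)] that(2) by simp
  have layer: "colorable E {x \<in> S. root x = z \<and> d x = i} (layer_bound k c)" for z i
    unfolding layer_bound_def
  proof (rule edge_interval_colorable)
    show "finite {x \<in> S. root x = z \<and> d x = i}" using finite by simp
    show "inj_on p {x \<in> S. root x = z \<and> d x = i}" by (rule inj_on_subset[OF inj]) blast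
    show "E y x" if "E x y" for x y using that by (rule E_sym)
    fix u v assume "u \<in> {x \<in> S. root x = z \<and> d x = i}" "v \<in> {x \<in> S. root x = z \<and> d x = i}"
      and p: "p u < p v" and uv: "E u v"
    then have u: "u \<in> S" "d u = i" "root u = z" and v: "v \<in> S" "d v = i" "root v = z" by auto
    have inside: False
      if "y \<in> S" "root y = z" "d y < i" "p u < p y" "p y < p v" "\<not> E y u" "\<not> E y v" for y
      using that
    proof (induction "d y" arbitrary: y rule: less_induct)
      case less
      show False
      proof (cases "d y = 0")
        case True
        then have "y = root u" using d_0[OF less.prems(1)] less.prems(2) u(3) by metis
        moreover have "p (root u) \<le> p u" using root[OF u(1)] by blast
        ultimately show False using less.prems(4) by simp
      next
        case False
        then obtain y' where y': "(y', y) \<in> r" "d y' + 1 = d y" using d_parent less.prems(1) by blast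
        have yS: "y' \<in> S" "E y' y" using y'(1) by (auto simp: r_def)
        \<comment> \<open>The parent lies at least two layers before layer \<open>i\<close>, too
          early to touch it; in particular it crosses neither \<open>u\<close> nor \<open>v\<close>
          and stays trapped.\<close>
        have far: "\<not> E y' w" if "w \<in> S" "d w = i" for w
          using d_step[of y' w] that yS y'(2) less.prems(3) by (auto simp: r_def)
        have "p u < p y' \<and> p y' < p v"
          using trapped_nbr[OF u(1) v(1) uv less.prems(1,4-7) yS] far[OF u(1,2)] far[OF v(1,2)] by blast
        moreover have "root y' = z" using root_eq[OF y'(1)] less.prems(2) by simp
        moreover have "d y' < d y" using y'(2) by simp
        ultimately show False
          using less.hyps[of y'] yS(1) less.prems(3) far[OF u(1,2)] far[OF v(1,2)] by auto
      qed
    qed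
    define L where "L = {x \<in> S. root x = z \<and> d x = i}"
    define T where "T = {x \<in> L. p u < p x \<and> p x < p v \<and> \<not> E x u \<and> \<not> E x v}"
    have "colorable E T (6 * (c * support_bound k c))"
    proof (rule trapped_colorable[OF u(1) v(1) uv])
      show "T \<subseteq> S" by (auto simp: T_def L_def)
      fix x assume "x \<in> T"
      then have x: "x \<in> S" "root x = z" "d x = i" "p u < p x" "p x < p v" "\<not> E x u" "\<not> E x v"
        by (auto simp: T_def L_def)
      then show "p u < p x \<and> p x < p v \<and> \<not> E x u \<and> \<not> E x v" by simp
      have "0 < d x"
      proof (rule ccontr)
        assume "\<not> 0 < d x"
        then have "u = v" using d_0[of u] d_0[of v] u v x(3) by simp
        then show False using p by simp
      qed
      then obtain y where y: "(y, x) \<in> r" "d y + 1 = d x" using d_parent x(1) by blast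
      then have yS: "y \<in> S" "E y x" by (auto simp: r_def)
      have "E y u \<or> E y v"
      proof (rule ccontr)
        assume n: "\<not> ?thesis"
        then have "p u < p y \<and> p y < p v"
          using trapped_nbr[OF u(1) v(1) uv x(1,4-7) yS] by blast
        then show False using inside[of y] yS root_eq[OF y(1)] x(2,3) y(2) n by auto
      qed
      then show "\<exists>y\<in>S. E y x \<and> (E y u \<or> E y v)" using yS by blast
    qed
    moreover have "colorable E {x \<in> L. x \<noteq> w \<and> E x w} c" if "w \<in> S" for w
      by (rule nbrs_colorable[OF _ that]) (auto simp: L_def)
    ultimately have "colorable E (({x \<in> L. x \<noteq> u \<and> E x u} \<union> {x \<in> L. x \<noteq> v \<and> E x v}) \<union> T)
        (c + c + 6 * (c * support_bound k c))"
      using u(1) v(1) by (intro colorable_Un) blast+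
    then show "colorable E {x \<in> {x \<in> S. root x = z \<and> d x = i}. p u < p x \<and> p x < p v}
        (c + c + 6 * (c * support_bound k c))"
      by (rule colorable_subset) (auto simp: T_def L_def)
  qed
  have comp: "colorable E {x \<in> S. root x = z} (2 * layer_bound k c)" for z
  proof (rule colorable_label_refine[where g = "\<lambda>x. d x mod 2"])
    fix i A assume A: "A \<subseteq> {x \<in> S. root x = z}" "\<And>x. x \<in> A \<Longrightarrow> d x mod 2 = i"
    show "colorable E A (layer_bound k c)"
    proof (rule colorable_components[where g = d])
      show "colorable E {x \<in> A. d x = j} (layer_bound k c)" for j
        by (rule colorable_subset[OF layer[of z j]]) (use A(1) in auto)
      fix x y assume xy: "x \<in> A" "y \<in> A" "x \<noteq> y" "E x y"
      then have "(x, y) \<in> r" using A(1) by (auto simp: r_def)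
      then have "d y \<le> d x + 1" "d x \<le> d y + 1" using d_step sym_r by blast+
      then have "d x = d y \<or> d x = Suc (d y) \<or> d y = Suc (d x)" by linarith
      moreover have "d x mod 2 = d y mod 2" using A(2) xy by simp
      ultimately show "d x = d y" by (auto simp: mod_Suc split: if_splits)
    qed
  qed simp
  show ?thesis
  proof (rule colorable_components[where g = root])
    show "colorable E {x \<in> S. root x = z} (2 * layer_bound k c)" for z by (rule comp)
    show "root x = root y" if "x \<in> S" "y \<in> S" "E x y" for x y
      using root_eq[of x y] that by (simp add: r_def)
  qed
qed

end

theorem crossing_system_chi_bounded:
  "0 < k \<Longrightarrow> \<exists>c. \<forall>S p t l. crossing_system (S :: 'a set) p t \<longrightarrow> clique_free (adj t l) S k \<longrightarrow>
     colorable (adj t l) S c"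
proof (induction k rule: nat_induct_non_zero)
  case 1
  have "S = {}" if "clique_free (adj t l) S 1" for S :: "'a set" and t l
  proof (rule ccontr)
    assume "S \<noteq> {}"
    then obtain x where "x \<in> S" by blast
    then have "card {x} < 1" using that unfolding clique_free_def by (metis clique_def empty_subsetI insert_subset singletonD)
    then show False by simp
  qed
  then show ?case by (intro exI[of _ 0] allI impI) (metis colorable_empty)
next
  case (Suc k)
  then obtain c where c: "\<And>S p t l. crossing_system (S :: 'a set) p t \<Longrightarrow> clique_free (adj t l) S k \<Longrightarrow>
     colorable (adj t l) S c" by blast
  have "colorable (adj t l) S (2 * layer_bound k c)"
    if "crossing_system (S :: 'a set) p t" "clique_free (adj t l) S (Suc k)" for S p t l
  proof -
    have "chi_step S p t l k c"
      by (intro chi_step.intro chi_step_axioms.intro that Suc.hyps c)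
    then show ?thesis by (rule chi_step.step_colorable)
  qed
  then show ?case by blast
qed

section \<open>Affine strings over a strip\<close>

lemma affine_root:
  fixes a b :: real
  assumes "u \<le> v" "a + b * u \<le> 0" "0 \<le> a + b * v"
  shows "\<exists>x. u \<le> x \<and> x \<le> v \<and> a + b * x = 0"
proof -
  have "continuous_on {u..v} (\<lambda>x. a + b * x)" by (intro continuous_intros)
  then show ?thesis using IVT'[of "\<lambda>x. a + b * x" u 0 v] assms by blast
qed

text \<open>\<open>(a z - a x) / (b z - b x)\<close> is the mediant of the fractions for
  \<open>x, y\<close> and for \<open>y, z\<close>. All denominators are positive by
  \<open>ord\<close>, and a mediant lies strictly between its fractions or equals both.\<close>

lemma fraction_system:
  fixes a b :: "'a \<Rightarrow> real"
  assumes "finite A" and ord: "\<And>x y. x \<in> A \<Longrightarrow> y \<in> A \<Longrightarrow> a x < a y \<longleftrightarrow> b x < b y" and "inj_on a A"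
  shows "crossing_system A a (\<lambda>x y. (a y - a x) / (b y - b x))"
proof
  show "(a y - a x) / (b y - b x) = (a x - a y) / (b x - b y)" for x y
    by (metis minus_diff_eq minus_divide_divide)
  fix x y z assume xyz: "x \<in> A" "y \<in> A" "z \<in> A" "a x < a y" "a y < a z"
  define p q u v where "p = a y - a x" and "q = b y - b x" and "u = a z - a y" and "v = b z - b y"
  have qv: "0 < q" "0 < v" using ord[of x y] ord[of y z] xyz by (auto simp: q_def v_def)
  have eq: "a z - a x = p + u" "b z - b x = q + v" by (simp_all add: p_def q_def u_def v_def)
  have "p / q < (p + u) / (q + v) \<longleftrightarrow> p * v < u * q" "(p + u) / (q + v) < u / v \<longleftrightarrow> p * v < u * q"
    "u / v < (p + u) / (q + v) \<longleftrightarrow> u * q < p * v" "(p + u) / (q + v) < p / q \<longleftrightarrow> u * q < p * v"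
    "p / q = (p + u) / (q + v) \<longleftrightarrow> p * v = u * q" "(p + u) / (q + v) = u / v \<longleftrightarrow> p * v = u * q"
    using qv by (simp_all add: divide_simps) (auto simp: algebra_simps)
  moreover have "p * v < u * q \<or> u * q < p * v \<or> p * v = u * q" by linarith
  ultimately have "p / q < (p + u) / (q + v) \<and> (p + u) / (q + v) < u / v \<or>
      u / v < (p + u) / (q + v) \<and> (p + u) / (q + v) < p / q \<or>
      p / q = (p + u) / (q + v) \<and> (p + u) / (q + v) = u / v" by blast
  then show "(a y - a x) / (b y - b x) < (a z - a x) / (b z - b x) \<and>
       (a z - a x) / (b z - b x) < (a z - a y) / (b z - b y) \<or>
       (a z - a y) / (b z - b y) < (a z - a x) / (b z - b x) \<and>
       (a z - a x) / (b z - b x) < (a y - a x) / (b y - b x) \<or>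
       (a y - a x) / (b y - b x) = (a z - a x) / (b z - b x) \<and>
       (a z - a x) / (b z - b x) = (a z - a y) / (b z - b y)"
    unfolding eq p_def[symmetric] q_def[symmetric] u_def[symmetric] v_def[symmetric] .
qed (use assms in auto)

section \<open>Crossings inside and beside a strip\<close>

text \<open>The type argument names the element type, which is bound inside the body and visible in
  neither \<open>k\<close> nor \<open>C\<close>.\<close>

definition chi_bounding :: "'a itself \<Rightarrow> nat \<Rightarrow> nat \<Rightarrow> bool" where
  "chi_bounding TYPE('a) k C \<longleftrightarrow> (\<forall>S p t l. crossing_system (S :: 'a set) p t \<longrightarrow>
     clique_free (adj t l) S k \<longrightarrow> colorable (adj t l) S C)"

text \<open>In these lemmas \<open>x\<close> stands for the graph of \<open>u \<mapsto> c x + m x * u\<close> over an interval.\<close>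
lemma left_crossings_colorable:
  fixes lo c m :: "'a \<Rightarrow> real"
  assumes C: "chi_bounding TYPE('a) k C" and "finite A" "u < v"
    and lo: "\<And>x. x \<in> A \<Longrightarrow> lo x \<le> u"
    and ord: "\<And>x y. x \<in> A \<Longrightarrow> y \<in> A \<Longrightarrow> x \<noteq> y \<Longrightarrow>
      c x + m x * u < c y + m y * u \<and> c x + m x * v < c y + m y * v \<or>
      c y + m y * u < c x + m x * u \<and> c y + m y * v < c x + m x * v"
    and cf: "clique_free (\<lambda>x y. \<exists>w\<le>u. lo x \<le> w \<and> lo y \<le> w \<and> c x + m x * w = c y + m y * w) A k"
      (is "clique_free ?L A k")
  shows "colorable (\<lambda>x y. \<exists>w\<le>u. lo x \<le> w \<and> lo y \<le> w \<and> c x + m x * w = c y + m y * w) A C"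
proof -
  define a b where "a x = c x + m x * u" and "b x = c x + m x * v" for x
  \<comment> \<open>Lines that meet at distance \<open>\<mu> * (v - u)\<close> to the left of
    \<open>u\<close> have gaps at \<open>u\<close> and \<open>v\<close> in the ratio \<mu> to 1 +
    \<mu>. So the extent of \<open>x\<close> to the left, in strip widths, becomes the length
    \<open>\<mu> x / (1 + \<mu> x)\<close>, while lines that do not meet on the left have a time of
    at least 1.\<close>
  define t where "t x y = (a y - a x) / (b y - b x)" for x y
  define \<mu> where "\<mu> x = (u - lo x) / (v - u)" for x
  define l where "l x = \<mu> x / (1 + \<mu> x)" for x
  have ord': "a x < a y \<longleftrightarrow> b x < b y" if "x \<in> A" "y \<in> A" for x y
    using ord[of x y] that by (cases "x = y") (auto simp: a_def b_def)
  have sys: "crossing_system A a t"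
    unfolding t_def
  proof (rule fraction_system[OF assms(2) ord'])
    show "inj_on a A" using ord by (intro inj_onI) (force simp: a_def)
  qed
  have val: "a y - a x - (b y - b x - (a y - a x)) * ((u - z) / (v - u)) = (c y - c x) + (m y - m x) * z" for x y z
    using \<open>u < v\<close> by (simp add: a_def b_def divide_simps) (simp add: algebra_simps)
  have t_le: "t x y \<le> l z \<longleftrightarrow> (c y - c x) + (m y - m x) * lo z \<le> 0"
    if "x \<in> A" "y \<in> A" "z \<in> A" "a x < a y" for x y z
  proof -
    have pos: "0 < b y - b x" using ord'[of x y] that by simp
    have \<mu>: "0 \<le> \<mu> z" using lo[OF that(3)] \<open>u < v\<close> by (simp add: \<mu>_def)
    have "t x y \<le> l z \<longleftrightarrow> (a y - a x) * (1 + \<mu> z) \<le> \<mu> z * (b y - b x)"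
      using pos \<mu> by (simp add: t_def l_def divide_simps)
    also have "\<dots> \<longleftrightarrow> a y - a x - (b y - b x - (a y - a x)) * \<mu> z \<le> 0"
      by (simp add: algebra_simps)
    finally show ?thesis unfolding \<mu>_def val .
  qed
  have *: "adj t l x y \<longleftrightarrow> ?L x y" if xy: "x \<in> A" "y \<in> A" "a x < a y" for x y
  proof
    assume "adj t l x y"
    then have "(c y - c x) + (m y - m x) * lo x \<le> 0" "(c y - c x) + (m y - m x) * lo y \<le> 0"
      using t_le xy by (auto simp: adj_def)
    then have "(c y - c x) + (m y - m x) * max (lo x) (lo y) \<le> 0" by (simp add: max_def)
    moreover have "0 \<le> (c y - c x) + (m y - m x) * u" using xy(3) by (simp add: a_def algebra_simps)
    moreover have "max (lo x) (lo y) \<le> u" using lo xy by simp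
    ultimately obtain w where "max (lo x) (lo y) \<le> w" "w \<le> u" "(c y - c x) + (m y - m x) * w = 0"
      using affine_root by blast
    then show "?L x y" by (intro exI[of _ w]) (auto simp: algebra_simps)
  next
    assume "?L x y"
    then obtain w where w: "w \<le> u" "lo x \<le> w" "lo y \<le> w" "(c y - c x) + (m y - m x) * w = 0"
      by (auto simp: algebra_simps)
    have "0 < (c y - c x) + (m y - m x) * u" using xy(3) by (simp add: a_def algebra_simps)
    then have "0 < (m y - m x) * (u - w)" using w(4) by (simp add: algebra_simps)
    then have "0 \<le> m y - m x" using w(1) by (simp add: zero_less_mult_iff)
    then have "(m y - m x) * lo x \<le> (m y - m x) * w" "(m y - m x) * lo y \<le> (m y - m x) * w"
      using w by (auto intro: mult_left_mono)
    then show "adj t l x y" using t_le[of x y x] t_le[of x y y] xy w(4) by (auto simp: adj_def)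
  qed
  have adj: "adj t l x y \<longleftrightarrow> ?L x y" if "x \<in> A" "y \<in> A" "x \<noteq> y" for x y
  proof -
    have "a x < a y \<or> a y < a x" using ord[OF that] by (auto simp: a_def)
    moreover have "?L x y \<longleftrightarrow> ?L y x" by metis
    ultimately show ?thesis
      using *[of x y] *[of y x] crossing_system.adj_sym[OF sys, of l x y] that by metis
  qed
  have "clique_free (adj t l) A k" unfolding clique_free_def
  proof (intro allI impI)
    fix D assume D: "D \<subseteq> A" "clique (adj t l) D"
    have "clique ?L D" unfolding clique_def
    proof (intro ballI impI)
      fix x y assume xy: "x \<in> D" "y \<in> D" "x \<noteq> y"
      then have "adj t l x y" "x \<in> A" "y \<in> A" using D by (auto simp: clique_def)
      then show "?L x y" using adj xy(3) by simp
    qed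
    then show "card D < k" using cf D(1) by (simp add: clique_free_def)
  qed
  then have "colorable (adj t l) A C" using C sys by (simp add: chi_bounding_def)
  then show ?thesis by (rule colorable_cong) (use adj in auto)
qed

lemma strip_colorable:
  fixes lo hi c m :: "'a \<Rightarrow> real"
  defines "X \<equiv> \<lambda>x y. \<exists>w. lo x \<le> w \<and> lo y \<le> w \<and> w \<le> hi x \<and> w \<le> hi y \<and> c x + m x * w = c y + m y * w"
  assumes C: "chi_bounding TYPE('a) k C" and "finite S" "u < v"
    and lo: "\<And>x. x \<in> S \<Longrightarrow> lo x \<le> u" and hi: "\<And>x. x \<in> S \<Longrightarrow> v \<le> hi x"
    and cf: "clique_free X S k"
  shows "colorable X S (k * (C * C))"
proof -
  define a b where "a x = c x + m x * u" and "b x = c x + m x * v" for x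
  obtain e :: "'a \<Rightarrow> nat" where e: "bij_betw e S {0..<card S}"
    using ex_bij_betw_finite_nat[OF \<open>finite S\<close>] by blast
  \<comment> \<open>\<open>x\<close> passes from weakly below \<open>y\<close> at \<open>u\<close>
    to weakly above it at \<open>v\<close>. The index \<open>e\<close> orients pairs that coincide
    over the strip, which cross too.\<close>
  define R where "R x y \<longleftrightarrow> a x \<le> a y \<and> b y \<le> b x \<and> (a x \<noteq> a y \<or> b x \<noteq> b y \<or> e x < e y)" for x y
  have Xsym: "X x y \<Longrightarrow> X y x" for x y unfolding X_def by metis
  have R_X: "X x y" if "x \<in> S" "y \<in> S" "R x y" for x y
  proof -
    have "(c x - c y) + (m x - m y) * u \<le> 0" "0 \<le> (c x - c y) + (m x - m y) * v"
      using that(3) by (auto simp: R_def a_def b_def algebra_simps)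
    then obtain w where "u \<le> w" "w \<le> v" "(c x - c y) + (m x - m y) * w = 0"
      using affine_root[of u v] \<open>u < v\<close> by (meson less_imp_le)
    then show ?thesis unfolding X_def
      using lo[OF that(1)] lo[OF that(2)] hi[OF that(1)] hi[OF that(2)]
      by (intro exI[of _ w]) (auto simp: algebra_simps)
  qed
  have sub: "clique_free F A k"
    if "A \<subseteq> S" "\<And>x y. x \<in> A \<Longrightarrow> y \<in> A \<Longrightarrow> x \<noteq> y \<Longrightarrow> F x y \<Longrightarrow> X x y" for F A
    unfolding clique_free_def
  proof (intro allI impI)
    fix D assume D: "D \<subseteq> A" "clique F D"
    have "clique X D" unfolding clique_def
    proof (intro ballI impI)
      fix x y assume xy: "x \<in> D" "y \<in> D" "x \<noteq> y"
      then have "F x y" "x \<in> A" "y \<in> A" using D by (auto simp: clique_def)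
      then show "X x y" using that(2) xy(3) by simp
    qed
    moreover have "D \<subseteq> S" using D(1) that(1) by blast
    ultimately show "card D < k" using cf by (simp add: clique_free_def)
  qed
  have "colorable (\<lambda>x y. R x y \<or> R y x) S k"
  proof (rule colorable_height[OF \<open>finite S\<close>])
    show "R x z" if "R x y" "R y z" for x y z using that by (auto simp: R_def)
    show "\<not> R x x" for x by (simp add: R_def)
    show "clique_free (\<lambda>x y. R x y \<or> R y x) S k"
      by (rule sub[OF order_refl]) (use R_X Xsym in metis)
  qed
  then show ?thesis
  proof (rule colorable_refine)
    fix A assume A: "A \<subseteq> S" "indep (\<lambda>x y. R x y \<or> R y x) A"
    have finA: "finite A" using A(1) \<open>finite S\<close> finite_subset by blast
    have ord: "a x < a y \<and> b x < b y \<or> a y < a x \<and> b y < b x" if xy: "x \<in> A" "y \<in> A" "x \<noteq> y" for x y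
    proof -
      have "\<not> R x y" "\<not> R y x" using A(2) xy by (auto simp: indep_def)
      moreover have "e x < e y \<or> e y < e x"
        using e xy A(1) by (metis bij_betw_imp_inj_on inj_onD linorder_neqE_nat subsetD)
      ultimately show ?thesis unfolding R_def by linarith
    qed
    define L where "L x y \<longleftrightarrow> (\<exists>w\<le>u. lo x \<le> w \<and> lo y \<le> w \<and> c x + m x * w = c y + m y * w)" for x y
    \<comment> \<open>Crossings to the right of \<open>v\<close>, reflected by
      \<open>w \<mapsto> - w\<close> into the form of \<open>L\<close>.\<close>
    define L' where "L' x y \<longleftrightarrow> (\<exists>w\<le>- v. - hi x \<le> w \<and> - hi y \<le> w \<and> c x + (- m x) * w = c y + (- m y) * w)" for x y
    have L_X: "X x y" if xy: "x \<in> A" "y \<in> A" "L x y" for x y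
    proof -
      obtain w where w: "w \<le> u" "lo x \<le> w" "lo y \<le> w" "c x + m x * w = c y + m y * w"
        using xy(3) by (auto simp: L_def)
      then show ?thesis unfolding X_def
        using hi[of x] hi[of y] xy A(1) \<open>u < v\<close> by (intro exI[of _ w]) force
    qed
    have L'_X: "X x y" if xy: "x \<in> A" "y \<in> A" "L' x y" for x y
    proof -
      obtain w where w: "w \<le> - v" "- hi x \<le> w" "- hi y \<le> w" "c x + (- m x) * w = c y + (- m y) * w"
        using xy(3) by (auto simp: L'_def)
      then show ?thesis unfolding X_def
        using lo[of x] lo[of y] xy A(1) \<open>u < v\<close> by (intro exI[of _ "- w"]) force
    qed
    have cover: "L x y \<or> L' x y" if xy: "x \<in> A" "y \<in> A" "x \<noteq> y" "X x y" for x y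
    proof -
      obtain w where w: "lo x \<le> w" "lo y \<le> w" "w \<le> hi x" "w \<le> hi y" "c x + m x * w = c y + m y * w"
        using xy(4) by (auto simp: X_def)
      have no: False if "u < w" "w < v" "x \<in> A" "y \<in> A" "a x < a y" "b x < b y"
        "c x + m x * w = c y + m y * w" for x y
      proof -
        have 1: "0 < (m y - m x) * (u - w)" "0 < (m y - m x) * (v - w)"
          using that(5-7) unfolding a_def b_def by (simp_all add: left_diff_distrib right_diff_distrib)
        then show False using that(1,2) by (simp add: zero_less_mult_iff)
      qed
      consider "w \<le> u" | "v \<le> w" | "u < w" "w < v" by linarith
      then show ?thesis
      proof cases
        case 1
        then have "L x y" unfolding L_def using w by blast
        then show ?thesis ..
      next
        case 2
        then have "L' x y" unfolding L'_def using w by (intro exI[of _ "- w"]) simp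
        then show ?thesis ..
      next
        case 3
        from ord[OF xy(1-3)] have False
        proof
          assume "a x < a y \<and> b x < b y" then show False using no[of x y] 3 xy w(5) by blast
        next
          assume "a y < a x \<and> b y < b x" then show False using no[of y x] 3 xy w(5)[symmetric] by blast
        qed
        then show ?thesis ..
      qed
    qed
    have "colorable L A C" unfolding L_def
    proof (rule left_crossings_colorable[OF C finA \<open>u < v\<close>])
      show "lo x \<le> u" if "x \<in> A" for x using lo that A(1) by blast
      show "c x + m x * u < c y + m y * u \<and> c x + m x * v < c y + m y * v \<or>
        c y + m y * u < c x + m x * u \<and> c y + m y * v < c x + m x * v" if "x \<in> A" "y \<in> A" "x \<noteq> y" for x y
        using ord[OF that] by (auto simp: a_def b_def)
      show "clique_free (\<lambda>x y. \<exists>w\<le>u. lo x \<le> w \<and> lo y \<le> w \<and> c x + m x * w = c y + m y * w) A k"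
      proof (rule sub[OF A(1)])
        fix x y assume "x \<in> A" "y \<in> A" "\<exists>w\<le>u. lo x \<le> w \<and> lo y \<le> w \<and> c x + m x * w = c y + m y * w"
        then show "X x y" using L_X[of x y] unfolding L_def by blast
      qed
    qed
    then show "colorable X A (C * C)"
    proof (rule colorable_refine)
      fix B assume B: "B \<subseteq> A" "indep L B"
      have "colorable L' B C" unfolding L'_def
      proof (rule left_crossings_colorable[OF C, of B "- v" "- u"])
        show "finite B" using B(1) finA finite_subset by blast
        show "- v < - u" using \<open>u < v\<close> by simp
        show "- hi x \<le> - v" if "x \<in> B" for x using hi[of x] that A(1) B(1) by auto
        show "c x + - m x * - v < c y + - m y * - v \<and> c x + - m x * - u < c y + - m y * - u \<or>
          c y + - m y * - v < c x + - m x * - v \<and> c y + - m y * - u < c x + - m x * - u"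
          if "x \<in> B" "y \<in> B" "x \<noteq> y" for x y
        proof -
          have "x \<in> A" "y \<in> A" using that B(1) by auto
          then show ?thesis using ord[of x y] that(3) by (auto simp: a_def b_def)
        qed
        show "clique_free (\<lambda>x y. \<exists>w\<le>- v. - hi x \<le> w \<and> - hi y \<le> w \<and> c x + - m x * w = c y + - m y * w) B k"
        proof (rule sub)
          show "B \<subseteq> S" using A(1) B(1) by blast
          fix x y assume "x \<in> B" "y \<in> B"
            "\<exists>w\<le>- v. - hi x \<le> w \<and> - hi y \<le> w \<and> c x + - m x * w = c y + - m y * w"
          moreover from this have "x \<in> A" "y \<in> A" using B(1) by auto
          ultimately show "X x y" using L'_X[of x y] unfolding L'_def by blast
        qed
      qed
      then show "colorable X B C"
      proof (rule colorable_cong)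
        fix x y assume "x \<in> B" "y \<in> B" "x \<noteq> y" "X x y"
        moreover from this have "\<not> L x y" using B(2) by (simp add: indep_def)
        moreover have "x \<in> A" "y \<in> A" using calculation B(1) by auto
        ultimately show "L' x y" using cover by blast
      qed simp
    qed
  qed
qed

text \<open>A width of at least \<open>2 * h\<close> contains a full grid cell. Segments with equal
  first grid line \<open>i\<close> and equal \<open>j - i\<close> share a strip; those with distinct
  \<open>i\<close> in one residue class mod \<open>N + 2\<close> are too far apart to meet, their
  widths being at most \<open>N * h\<close>.\<close>

lemma grid_colorable:
  fixes lo hi c m :: "'a \<Rightarrow> real"
  defines "X \<equiv> \<lambda>x y. \<exists>w. lo x \<le> w \<and> lo y \<le> w \<and> w \<le> hi x \<and> w \<le> hi y \<and> c x + m x * w = c y + m y * w"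
  assumes C: "chi_bounding TYPE('a) k C" and "finite S" "0 < h"
    and len: "\<And>x. x \<in> S \<Longrightarrow> 2 * h \<le> hi x - lo x \<and> hi x - lo x \<le> real N * h"
    and cf: "clique_free X S k"
  shows "colorable X S ((N + 1) * ((N + 2) * (k * (C * C))))"
proof -
  define i where "i x = \<lceil>lo x / h\<rceil>" for x
  define j where "j x = \<lfloor>hi x / h\<rfloor>" for x
  have i: "lo x \<le> of_int (i x) * h" "(of_int (i x) - 1) * h < lo x" for x
  proof -
    have "lo x / h \<le> of_int (i x)" "of_int (i x) - 1 < lo x / h" unfolding i_def by linarith+
    then show "lo x \<le> of_int (i x) * h" "(of_int (i x) - 1) * h < lo x"
      using \<open>0 < h\<close> by (simp_all add: pos_divide_le_eq pos_less_divide_eq)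
  qed
  have j: "of_int (j x) * h \<le> hi x" "hi x < (of_int (j x) + 1) * h" for x
  proof -
    have "of_int (j x) \<le> hi x / h" "hi x / h < of_int (j x) + 1" unfolding j_def by linarith+
    then show "of_int (j x) * h \<le> hi x" "hi x < (of_int (j x) + 1) * h"
      using \<open>0 < h\<close> by (simp_all add: pos_le_divide_eq pos_divide_less_eq)
  qed
  have ij: "i x < j x" "j x - i x \<le> int N" if "x \<in> S" for x
  proof -
    have "0 < (of_int (j x) - of_int (i x)) * h" using i(2)[of x] j(2)[of x] len[OF that] by (simp add: algebra_simps)
    then show "i x < j x" using \<open>0 < h\<close> by (simp add: zero_less_mult_iff)
    have "(of_int (j x) - of_int (i x)) * h \<le> real N * h" using i(1)[of x] j(1)[of x] len[OF that] by (simp add: algebra_simps)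
    then have "of_int (j x) - of_int (i x) \<le> real N" using \<open>0 < h\<close> by simp
    then show "j x - i x \<le> int N" by linarith
  qed
  show ?thesis
  proof (rule colorable_label_refine[where g = "\<lambda>x. nat (j x - i x)"])
    show "nat (j x - i x) < N + 1" if "x \<in> S" for x using ij(2)[OF that] by linarith
    fix q A assume A: "A \<subseteq> S" "\<And>x. x \<in> A \<Longrightarrow> nat (j x - i x) = q"
    show "colorable X A ((N + 2) * (k * (C * C)))"
    proof (rule colorable_label_refine[where g = "\<lambda>x. nat (i x mod int (N + 2))"])
      show "nat (i x mod int (N + 2)) < N + 2" for x
        using pos_mod_bound[of "int (N + 2)" "i x"] by linarith
      fix s B assume B: "B \<subseteq> A" "\<And>x. x \<in> B \<Longrightarrow> nat (i x mod int (N + 2)) = s"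
      show "colorable X B (k * (C * C))"
      proof (rule colorable_components[where g = i])
        fix z
        show "colorable X {x \<in> B. i x = z} (k * (C * C))" unfolding X_def
        proof (rule strip_colorable[OF C])
          show "finite {x \<in> B. i x = z}" 
            by (rule finite_subset[OF _ \<open>finite S\<close>]) (use A(1) B(1) in auto)
          show "lo x \<le> of_int z * h" if "x \<in> {x \<in> B. i x = z}" for x using i(1)[of x] that by auto
          \<comment> \<open>Members of the class have \<open>j x - i x = q\<close> with
            \<open>q\<close> at least 1; the maximum keeps the strip nondegenerate when the class is
            empty.\<close>
          show "of_int (z + max 1 (int q)) * h \<le> hi x" if "x \<in> {x \<in> B. i x = z}" for x
          proof -
            have "x \<in> S" "nat (j x - i x) = q" using that A B(1) by auto
            then have "j x = z + max 1 (int q)" using ij[of x] that by auto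
            then show ?thesis using j(1)[of x] by simp
          qed
          have "0 < of_int (max 1 (int q)) * h" using \<open>0 < h\<close> by (intro mult_pos_pos) auto
          then show "of_int z * h < of_int (z + max 1 (int q)) * h" by (simp only: of_int_add distrib_right)
          show "clique_free (\<lambda>x y. \<exists>w. lo x \<le> w \<and> lo y \<le> w \<and> w \<le> hi x \<and> w \<le> hi y \<and>
              c x + m x * w = c y + m y * w) {x \<in> B. i x = z} k"
            by (rule clique_free_subset[OF cf[unfolded X_def]]) (use A(1) B(1) in auto)
        qed
      next
        have *: False if xy: "x \<in> B" "y \<in> B" "X x y" "i x < i y" for x y
        proof -
          have S: "x \<in> S" "y \<in> S" using xy A(1) B(1) by auto
          have "i x mod int (N + 2) = i y mod int (N + 2)"
          proof -
            have "nat (i x mod int (N + 2)) = nat (i y mod int (N + 2))" using B(2) xy(1,2) by simp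
            moreover have "0 \<le> i x mod int (N + 2)" "0 \<le> i y mod int (N + 2)" by simp_all
            ultimately show ?thesis by linarith
          qed
          then have "int (N + 2) dvd i y - i x" using mod_eq_dvd_iff[of "i y" "int (N + 2)" "i x"] by simp
          then have "int (N + 2) \<le> i y - i x" using xy(4) by (intro zdvd_imp_le) auto
          then have "j x + 1 \<le> i y - 1" using ij(2)[OF S(1)] by simp
          then have "of_int (j x) + 1 \<le> (of_int (i y) - 1 :: real)" by linarith
          then have "(of_int (j x) + 1) * h \<le> (of_int (i y) - 1) * h"
            using \<open>0 < h\<close> by (intro mult_right_mono) auto
          then have "hi x < lo y" using i(2)[of y] j(2)[of x] by linarith
          then show False using xy(3) by (auto simp: X_def)
        qed
        fix x y assume xy: "x \<in> B" "y \<in> B" "X x y"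
        have "X y x" using xy(3) unfolding X_def by metis
        then have "\<not> i x < i y" "\<not> i y < i x" using *[of x y] *[of y x] xy by blast+
        then show "i x = i y" by simp
      qed
    qed
  qed
qed

section \<open>Segments in the plane\<close>

text \<open>The coordinates are abstract so that steep segments can be treated as graphs over the
  second axis.\<close>

lemma closed_segment_as_graph:
  fixes P Q :: plane and a b :: 2
  assumes ab: "UNIV = {a, b}" "a \<noteq> b" and lt: "P $ a < Q $ a"
  shows "\<exists>c m. closed_segment P Q = {R. P $ a \<le> R $ a \<and> R $ a \<le> Q $ a \<and> R $ b = c + m * R $ a}"
proof -
  define m where "m = (Q $ b - P $ b) / (Q $ a - P $ a)"
  define c where "c = P $ b - m * P $ a"
  have m: "m * (Q $ a - P $ a) = Q $ b - P $ b" using lt by (simp add: m_def)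
  have vec_eq: "R = R' \<longleftrightarrow> R $ a = R' $ a \<and> R $ b = R' $ b" for R R' :: plane
  proof -
    have "R = R' \<longleftrightarrow> (\<forall>i\<in>{a, b}. R $ i = R' $ i)" unfolding ab(1)[symmetric] by (simp add: vec_eq_iff)
    then show ?thesis by simp
  qed
  have line: "R $ b = c + m * R $ a \<longleftrightarrow> R $ b = (1 - u) * P $ b + u * Q $ b"
    if "R $ a = (1 - u) * P $ a + u * Q $ a" for R u
  proof -
    have "c + m * R $ a = P $ b + u * (m * (Q $ a - P $ a))"
      unfolding that c_def by (simp add: algebra_simps)
    also have "\<dots> = (1 - u) * P $ b + u * Q $ b" unfolding m by (simp add: algebra_simps)
    finally show ?thesis by simp
  qed
  have "R \<in> closed_segment P Q \<longleftrightarrow> P $ a \<le> R $ a \<and> R $ a \<le> Q $ a \<and> R $ b = c + m * R $ a" for R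
  proof
    assume "R \<in> closed_segment P Q"
    then obtain u where u: "0 \<le> u" "u \<le> 1" "R = (1 - u) *\<^sub>R P + u *\<^sub>R Q"
      by (auto simp: closed_segment_def)
    have Ra: "R $ a = (1 - u) * P $ a + u * Q $ a" and Rb: "R $ b = (1 - u) * P $ b + u * Q $ b"
      by (simp_all add: u(3))
    have "0 \<le> u * (Q $ a - P $ a)" "u * (Q $ a - P $ a) \<le> 1 * (Q $ a - P $ a)"
      using u lt by (auto intro!: mult_nonneg_nonneg mult_right_mono)
    then show "P $ a \<le> R $ a \<and> R $ a \<le> Q $ a \<and> R $ b = c + m * R $ a"
      using Ra line[OF Ra] Rb by (simp add: algebra_simps)
  next
    assume R: "P $ a \<le> R $ a \<and> R $ a \<le> Q $ a \<and> R $ b = c + m * R $ a"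
    define u where "u = (R $ a - P $ a) / (Q $ a - P $ a)"
    have u: "0 \<le> u" "u \<le> 1" using R lt by (auto simp: u_def)
    have "u * (Q $ a - P $ a) = R $ a - P $ a" using lt by (simp add: u_def)
    then have Ra: "R $ a = (1 - u) * P $ a + u * Q $ a" by (simp add: algebra_simps)
    then have "R $ b = (1 - u) * P $ b + u * Q $ b" using line R by blast
    then have "R = (1 - u) *\<^sub>R P + u *\<^sub>R Q" unfolding vec_eq using Ra by simp
    then show "R \<in> closed_segment P Q" unfolding closed_segment_def using u by blast
  qed
  then show ?thesis by blast
qed

lemma direction_colorable:
  fixes S :: "plane set set" and a b :: 2
  assumes ab: "UNIV = {a, b}" "a \<noteq> b" and C: "chi_bounding TYPE(plane set) k C"
    and "finite S" "0 < h"
    and len: "\<And>s. s \<in> S \<Longrightarrow> \<exists>P Q. s = closed_segment P Q \<and> 2 * h \<le> \<bar>P $ a - Q $ a\<bar> \<and> \<bar>P $ a - Q $ a\<bar> \<le> real N * h"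
    and cf: "clique_free (\<lambda>s s'. s \<inter> s' \<noteq> {}) S k"
  shows "colorable (\<lambda>s s'. s \<inter> s' \<noteq> {}) S ((N + 1) * ((N + 2) * (k * (C * C))))"
proof -
  have "\<exists>lo hi c m. s = {R. lo \<le> R $ a \<and> R $ a \<le> hi \<and> R $ b = c + m * R $ a} \<and>
      2 * h \<le> hi - lo \<and> hi - lo \<le> real N * h" if s: "s \<in> S" for s
  proof -
    obtain P Q where PQ: "s = closed_segment P Q" "2 * h \<le> \<bar>P $ a - Q $ a\<bar>" "\<bar>P $ a - Q $ a\<bar> \<le> real N * h"
      using len[OF s] by blast
    show ?thesis
    proof (cases "P $ a < Q $ a")
      case True
      from closed_segment_as_graph[OF ab this] PQ True show ?thesis by fastforce
    next
      case False
      then have lt: "Q $ a < P $ a" using PQ(2) \<open>0 < h\<close> by simp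
      have "s = closed_segment Q P" using PQ(1) by (simp add: closed_segment_commute)
      with closed_segment_as_graph[OF ab lt] PQ(2,3) lt show ?thesis by fastforce
    qed
  qed
  then have "\<forall>s\<in>S. \<exists>q. s = {R. fst q \<le> R $ a \<and> R $ a \<le> fst (snd q) \<and>
      R $ b = fst (snd (snd q)) + snd (snd (snd q)) * R $ a} \<and>
      2 * h \<le> fst (snd q) - fst q \<and> fst (snd q) - fst q \<le> real N * h"
    by simp
  from bchoice[OF this] obtain q where q: "\<forall>s\<in>S. s = {R. fst (q s) \<le> R $ a \<and> R $ a \<le> fst (snd (q s)) \<and>
      R $ b = fst (snd (snd (q s))) + snd (snd (snd (q s))) * R $ a} \<and>
      2 * h \<le> fst (snd (q s)) - fst (q s) \<and> fst (snd (q s)) - fst (q s) \<le> real N * h" ..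
  define lo hi c m where "lo s = fst (q s)" and "hi s = fst (snd (q s))" and
    "c s = fst (snd (snd (q s)))" and "m s = snd (snd (snd (q s)))" for s
  have s_eq: "R \<in> s \<longleftrightarrow> lo s \<le> R $ a \<and> R $ a \<le> hi s \<and> R $ b = c s + m s * R $ a" if "s \<in> S" for s R
    using bspec[OF q that] unfolding lo_def hi_def c_def m_def by blast
  have wid: "2 * h \<le> hi s - lo s \<and> hi s - lo s \<le> real N * h" if "s \<in> S" for s
    using bspec[OF q that] unfolding lo_def hi_def by blast
  have meet: "s \<inter> s' \<noteq> {} \<longleftrightarrow>
      (\<exists>w. lo s \<le> w \<and> lo s' \<le> w \<and> w \<le> hi s \<and> w \<le> hi s' \<and> c s + m s * w = c s' + m s' * w)"
    if S: "s \<in> S" "s' \<in> S" for s s'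
  proof
    assume "s \<inter> s' \<noteq> {}"
    then obtain R where "R \<in> s" "R \<in> s'" by blast
    then show "\<exists>w. lo s \<le> w \<and> lo s' \<le> w \<and> w \<le> hi s \<and> w \<le> hi s' \<and> c s + m s * w = c s' + m s' * w"
      using s_eq[OF S(1)] s_eq[OF S(2)] by (intro exI[of _ "R $ a"]) auto
  next
    assume "\<exists>w. lo s \<le> w \<and> lo s' \<le> w \<and> w \<le> hi s \<and> w \<le> hi s' \<and> c s + m s * w = c s' + m s' * w"
    then obtain w where w: "lo s \<le> w" "lo s' \<le> w" "w \<le> hi s" "w \<le> hi s'" "c s + m s * w = c s' + m s' * w"
      by blast
    define R :: plane where "R = (\<chi> i. if i = a then w else c s + m s * w)"
    have "R $ a = w" "R $ b = c s + m s * w" using ab(2) by (auto simp: R_def)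
    then have "R \<in> s" "R \<in> s'" using s_eq[OF S(1)] s_eq[OF S(2)] w by simp_all
    then show "s \<inter> s' \<noteq> {}" by blast
  qed
  have "colorable (\<lambda>s s'. \<exists>w. lo s \<le> w \<and> lo s' \<le> w \<and> w \<le> hi s \<and> w \<le> hi s' \<and>
      c s + m s * w = c s' + m s' * w) S ((N + 1) * ((N + 2) * (k * (C * C))))"
  proof (rule grid_colorable[OF C \<open>finite S\<close> \<open>0 < h\<close> wid])
    show "clique_free (\<lambda>s s'. \<exists>w. lo s \<le> w \<and> lo s' \<le> w \<and> w \<le> hi s \<and> w \<le> hi s' \<and>
      c s + m s * w = c s' + m s' * w) S k"
      unfolding clique_free_def
    proof (intro allI impI)
      fix D assume D: "D \<subseteq> S" "clique (\<lambda>s s'. \<exists>w. lo s \<le> w \<and> lo s' \<le> w \<and> w \<le> hi s \<and> w \<le> hi s' \<and>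
        c s + m s * w = c s' + m s' * w) D"
      have "clique (\<lambda>s s'. s \<inter> s' \<noteq> {}) D" unfolding clique_def
      proof (intro ballI impI)
        fix s s' assume s: "s \<in> D" "s' \<in> D" "s \<noteq> s'"
        then have "s \<in> S" "s' \<in> S" using D(1) by auto
        from meet[OF this] show "s \<inter> s' \<noteq> {}" using bspec[OF bspec[OF D(2)[unfolded clique_def] s(1)] s(2)] s(3) by blast
      qed
      then show "card D < k" using cf D(1) by (simp add: clique_free_def)
    qed
  qed
  then show ?thesis by (rule colorable_cong) (use meet in auto)
qed

lemma dist_le_coordinates:
  fixes P Q :: plane
  shows "dist P Q \<le> \<bar>P $ 1 - Q $ 1\<bar> + \<bar>P $ 2 - Q $ 2\<bar>"
  using norm_le_l1_cart[of "P - Q"] by (simp add: dist_norm sum_2)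

text \<open>A segment of length at least \<open>d\<close> has extent at least \<open>d / 2\<close>
  along some axis, hence two grid steps for \<open>h = d / 4\<close>; the upper bound
  \<open>N * d\<close> is \<open>4 * N\<close> steps. The factor 2 is the choice of the
  axis.\<close>

lemma bounded_ratio_colorable:
  fixes S :: "plane set set"
  assumes C: "chi_bounding TYPE(plane set) k C" and "finite S" "0 < d" "r \<le> real N"
    and seg: "\<And>s. s \<in> S \<Longrightarrow> \<exists>P Q. s = closed_segment P Q \<and> d \<le> dist P Q \<and> dist P Q \<le> r * d"
    and cf: "clique_free (\<lambda>s s'. s \<inter> s' \<noteq> {}) S k"
  shows "colorable (\<lambda>s s'. s \<inter> s' \<noteq> {}) S (2 * ((4 * N + 1) * ((4 * N + 2) * (k * (C * C)))))"
proof -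
  define flat where "flat a s \<longleftrightarrow> (\<exists>P Q. s = closed_segment P Q \<and>
      2 * (d / 4) \<le> \<bar>P $ a - Q $ a\<bar> \<and> \<bar>P $ a - Q $ a\<bar> \<le> real (4 * N) * (d / 4))" for a :: 2 and s
  have two: "UNIV = {1, 2 :: 2}" "UNIV = {2, 1 :: 2}" "(1 :: 2) \<noteq> 2" "(2 :: 2) \<noteq> 1"
    using UNIV_2 by auto
  have flat: "flat 1 s \<or> flat 2 s" if s: "s \<in> S" for s
  proof -
    obtain P Q where PQ: "s = closed_segment P Q" "d \<le> dist P Q" "dist P Q \<le> r * d"
      using seg[OF s] by blast
    have "r * d \<le> real N * d" using assms by (intro mult_right_mono) auto
    then have "dist P Q \<le> real (4 * N) * (d / 4)" using PQ(3) by simp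
    then have "\<bar>P $ a - Q $ a\<bar> \<le> real (4 * N) * (d / 4)" for a
      using component_le_norm_cart[of "P - Q" a] unfolding dist_norm vector_minus_component by linarith
    moreover have "2 * (d / 4) \<le> \<bar>P $ 1 - Q $ 1\<bar> \<or> 2 * (d / 4) \<le> \<bar>P $ 2 - Q $ 2\<bar>"
      using dist_le_coordinates[of P Q] PQ(2) by linarith
    ultimately show ?thesis unfolding flat_def using PQ(1) by blast
  qed
  show ?thesis
  proof (rule colorable_label_refine[where g = "\<lambda>s. if flat 1 s then 0 else 1"])
    fix i A assume A: "A \<subseteq> S" "\<And>s. s \<in> A \<Longrightarrow> (if flat 1 s then 0 else 1 :: nat) = i"
    have fin: "finite A" using A(1) \<open>finite S\<close> finite_subset by blast
    have cfA: "clique_free (\<lambda>s s'. s \<inter> s' \<noteq> {}) A k" using cf A(1) by (rule clique_free_subset)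
    have d4: "0 < d / 4" using \<open>0 < d\<close> by simp
    show "colorable (\<lambda>s s'. s \<inter> s' \<noteq> {}) A ((4 * N + 1) * ((4 * N + 2) * (k * (C * C))))"
    proof (cases "i = 0")
      case True
      have "flat 1 s" if "s \<in> A" for s using A(2)[OF that] True by (simp split: if_splits)
      then show ?thesis
        using direction_colorable[OF two(1,3) C fin d4 _ cfA] unfolding flat_def by blast
    next
      case False
      have "flat 2 s" if "s \<in> A" for s
      proof -
        have "\<not> flat 1 s" using A(2)[OF that] False by auto
        then show ?thesis using flat[of s] that A(1) by blast
      qed
      then show ?thesis
        using direction_colorable[OF two(2,4) C fin d4 _ cfA] unfolding flat_def by blast
    qed
  qed simp
qed

theorem theorem1p3:
  fixes k :: nat and r :: real
  assumes "k \<ge> 1" and "r \<ge> 1"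
  shows "\<exists>c::nat. \<forall>S :: plane set set.
           finite S \<longrightarrow>
           (\<forall>s\<in>S. is_segment s) \<longrightarrow>
           \<not> (\<exists>K. is_clique (intersection_graph S) K \<and> card K = k) \<longrightarrow>
           (S \<noteq> {} \<longrightarrow> Max (segment_length ` S) / Min (segment_length ` S) \<le> r) \<longrightarrow>
           chromatic_number (intersection_graph S) \<le> c"
proof -
  obtain C where C: "chi_bounding TYPE(plane set) k C"
    using crossing_system_chi_bounded[where 'a = "plane set", of k] assms(1) unfolding chi_bounding_def by auto
  define N where "N = nat \<lceil>r\<rceil>"
  have N: "r \<le> real N" unfolding N_def by linarith
  have "chromatic_number (intersection_graph S) \<le> 2 * ((4 * N + 1) * ((4 * N + 2) * (k * (C * C))))"
    if fin: "finite S" and seg: "\<forall>s\<in>S. is_segment s"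
      and no_clique: "\<not> (\<exists>K. is_clique (intersection_graph S) K \<and> card K = k)"
      and ratio: "S \<noteq> {} \<longrightarrow> Max (segment_length ` S) / Min (segment_length ` S) \<le> r"
    for S :: "plane set set"
  proof -
    \<comment> \<open>The value 1 for the empty family only keeps \<open>d\<close> positive.\<close>
    define d where "d = (if S = {} then 1 else Min (segment_length ` S))"
    have len_pos: "0 < segment_length s" if "s \<in> S" for s
      using seg that by (auto simp: is_segment_def)
    have d: "0 < d"
    proof (cases "S = {}")
      case False
      have "Min (segment_length ` S) \<in> segment_length ` S" using fin False by (intro Min_in) auto
      then show ?thesis using len_pos False by (auto simp: d_def)
    qed (simp add: d_def)
    have "\<exists>P Q. s = closed_segment P Q \<and> d \<le> dist P Q \<and> dist P Q \<le> r * d" if s: "s \<in> S" for s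
    proof -
      obtain P Q where PQ: "s = closed_segment P Q" using seg s by (auto simp: is_segment_def)
      have ne: "S \<noteq> {}" using s by blast
      have "d \<le> segment_length s" using fin s ne by (simp add: d_def)
      moreover have "segment_length s \<le> Max (segment_length ` S)" using fin s by simp
      moreover have "Max (segment_length ` S) \<le> r * d"
        using ratio ne d by (simp add: d_def pos_divide_le_eq)
      ultimately show ?thesis using PQ by (intro exI[of _ P] exI[of _ Q]) simp
    qed
    moreover have "clique_free (\<lambda>s s'. s \<inter> s' \<noteq> {}) S k" unfolding clique_free_def
    proof (intro allI impI, rule ccontr)
      fix D assume D: "D \<subseteq> S" "clique (\<lambda>s s'. s \<inter> s' \<noteq> {}) D" "\<not> card D < k"
      then obtain K where K: "K \<subseteq> D" "card K = k" by (meson not_less obtain_subset_with_card_n)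
      have "pairwise (\<lambda>s s'. (s, s') \<in> parcs (intersection_graph S)) K"
      proof (rule pairwiseI)
        fix s s' assume s: "s \<in> K" "s' \<in> K" "s \<noteq> s'"
        then have "s \<in> D" "s' \<in> D" using K(1) by auto
        then have "s \<inter> s' \<noteq> {}" using D(2) s(3) unfolding clique_def by simp
        then show "(s, s') \<in> parcs (intersection_graph S)"
          using \<open>s \<in> D\<close> \<open>s' \<in> D\<close> D(1) s(3) by (auto simp: intersection_graph_def)
      qed
      then have "is_clique (intersection_graph S) K"
        unfolding is_clique_def using K(1) D(1) by (auto simp: intersection_graph_def)
      then show False using no_clique K(2) by blast
    qed
    ultimately have "colorable (\<lambda>s s'. s \<inter> s' \<noteq> {}) S (2 * ((4 * N + 1) * ((4 * N + 2) * (k * (C * C)))))"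
      using bounded_ratio_colorable[OF C fin d N] by blast
    then obtain f where f: "f ` S \<subseteq> {..<2 * ((4 * N + 1) * ((4 * N + 2) * (k * (C * C))))}"
      "\<forall>s\<in>S. \<forall>s'\<in>S. s \<inter> s' \<noteq> {} \<longrightarrow> s \<noteq> s' \<longrightarrow> f s \<noteq> f s'"
      unfolding colorable_def by (elim exE conjE)
    have "proper_coloring (intersection_graph S) (2 * ((4 * N + 1) * ((4 * N + 2) * (k * (C * C))))) f"
      unfolding proper_coloring_def intersection_graph_def using f by auto
    then show ?thesis unfolding chromatic_number_def by (intro Least_le) blast
  qed
  then show ?thesis by blast
qed

end
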